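(* Let $m$ be an odd positive integer, $n\ge1$, let $D\subset\mathbb{C}^n$ be open and symmetric, let $h\in\{1,\dots,n\}$, and let $f=\mathcal{I}(F)\in\mathcal{S}(\Omega_D)$, with $F=\sum_{K\in\mathcal{P}(n)}\varepsilon_KF_K$ of class $C^1$, satisfy $\frac{\partial f}{\partial x_h^c}=0$. Then for every integer $k\ge1$ and every $x=(\alpha_1+J_1\beta_1,\dots,\alpha_n+J_n\beta_n)\in\Omega_D$ with $\beta_h>0$, $$\Delta^k_{m+1,h}f'_{s,h}(x)=(m-3)\cdots(m-2k-1)\sum_{j=1}^ka_j^{(k)}\beta_h^{j-2k}\sum_{K\in\mathcal{P}(n),\,h\notin K}\big[J_K,\partial_{\beta_h}^j(F'_h)_K(w',\alpha_h+i\beta_h,w'')\big],$$ or, equivalently, $$\Delta^k_{m+1,h}f'_{s,h}(x)=(m-3)\cdots(m-2k-1)\sum_{j=1}^{k+1}a_j^{(k+1)}\beta_h^{j-2k-2}\sum_{K\in\mathcal{P}(n),\,h\notin K}\big[J_K,\partial_{\beta_h}^{j-1}F_{K\cup\{h\}}(w',\alpha_h+i\beta_h,w'')\big],$$ where $(F'_h)_K=\beta_h^{-1}F_{K\cup\{h\}}$, $w'=(\alpha_1+i\beta_1,\dots,\alpha_{h-1}+i\beta_{h-1})$, $w''=(\alpha_{h+1}+i\beta_{h+1},\dots,\alpha_n+i\beta_n)$, and $a_j^{(k)}:=\frac{(2k-j-1)!}{(j-1)!\,(k-j)!\,(-2)^{k-j}}$ for $1\le j\le k$. In particular, $f'_{s,h}$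 is $\gamma_m$-polyharmonic in $x_h$, i.e. $\Delta_{m+1,h}^{\gamma_m}f'_{s,h}=0$, where $\gamma_m=\frac{m-1}{2}$.
   Context: $\mathbb{R}_m$ is the real Clifford algebra generated by $e_1,\dots,e_m$ with $e_ie_j+e_je_i=-2\delta_{ij}$; $\mathbb{R}^{m+1}$ is identified with the paravectors $x_0+\sum_{i=1}^m x_ie_i$; $\mathbb{S}=\{x\in\mathbb{R}^{m+1}:x_0=0,\ \sum_{i=1}^m x_i^2=1\}$ (so $J^2=-1$ for $J\in\mathbb{S}$). Every $x\in\mathbb{R}^{m+1}$ is $\alpha+J\beta$ with $\alpha\in\mathbb{R}$, $\beta\ge0$, $J\in\mathbb{S}$. $\mathcal{P}(n)$ is the set of subsets of $\{1,\dots,n\}$; $\{\varepsilon_K\}_{K\in\mathcal{P}(n)}$ is a basis of $\mathbb{R}^{2^n}$. A set $D\subset\mathbb{C}^n$ is symmetric if it is invariant under conjugation of each single variable, $z\mapsto\bar z^h=(z_1,\dots,\bar z_h,\dots,z_n)$. Its circularization is $\Omega_D=\{(\alpha_1+J_1\beta_1,\dots,\alpha_n+J_n\beta_n):(\alpha_1+i\beta_1,\dots,\alpha_n+i\beta_n)\in D,\ J_1,\dots,J_n\in\mathbb{S}\}\subset(\mathbb{R}^{m+1})^n$. A stem function is $F=\sum_{K}\varepsilon_KF_K:D\to\mathbb{R}_m\otimes\mathbb{R}^{2^n}$, $F_K:D\to\mathbb{R}_m$, with $F_K(\bar z^h)=F_K(z)$ if $h\notin K$ and $F_K(\bar z^h)=-F_K(z)$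 if $h\in K$. For $K=\{k_1<\dots<k_p\}$ and $a\in\mathbb{R}_m$ put $[J_K,a]=J_{k_1}\cdots J_{k_p}a$ ($[J_\emptyset,a]=a$). $F$ induces the slice function $f=\mathcal{I}(F):\Omega_D\to\mathbb{R}_m$, $f(x)=\sum_K[J_K,F_K(z)]$ for $x=(\alpha_l+J_l\beta_l)_l$, $z=(\alpha_l+i\beta_l)_l$; $\mathcal{S}(\Omega_D)$ is the set of slice functions. Let $\mathcal{J}_h$ be the $\mathbb{R}_m$-linear map with $\mathcal{J}_h(\varepsilon_K)=\varepsilon_{K\cup\{h\}}$ if $h\notin K$, $\mathcal{J}_h(\varepsilon_K)=-\varepsilon_{K\setminus\{h\}}$ if $h\in K$. For $F$ of class $C^1$, $\frac{\partial f}{\partial x_h^c}=\mathcal{I}\big(\frac12(\partial_{\alpha_h}F+\mathcal{J}_h\partial_{\beta_h}F)\big)$; thus $\frac{\partial f}{\partial x_h^c}=0$ iff $\partial_{\alpha_h}F_K=\partial_{\beta_h}F_{K\cup\{h\}}$ and $\partial_{\beta_h}F_K=-\partial_{\alpha_h}F_{K\cup\{h\}}$ for all $K\not\ni h$. The spherical $x_h$-derivative is $f'_{s,h}=\mathcal{I}(F'_h)$, $F'_h=\sum_{h\notin K}\varepsilon_K\beta_h^{-1}F_{K\cup\{h\}}$, defined at the points of $\Omega_D$ with $x_h\notin\mathbb{R}$. $\Delta_{m+1,h}$ is the Laplacian with respect to the $m+1$ real coordinates of $x_h$.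
   Formalization: The final polyharmonicity claim is stated only for m ≥ 3, since for m = 1 one has γ_m = 0 and it would say f'_{s,h} = 0, which fails for f(x) = x (n = 1), where f'_s = 1; the two formulas cover every odd m. *)

theory Defs
  imports "HOL-Analysis.Analysis"
begin

section \<open>The real Clifford algebra with negative definite signature\<close>

text \<open>
  The generators \<open>e\<^sub>i\<close> are indexed by a finite linearly ordered type \<open>'m\<close>, so \<open>m = CARD('m)\<close>.
  The coordinate at \<open>A\<close> belongs to the basis element
  \<open>e\<^sub>A = e\<^bsub>a\<^sub>1\<^esub> \<cdots> e\<^bsub>a\<^sub>p\<^esub>\<close>, where \<open>A = {a\<^sub>1 < \<dots> < a\<^sub>p}\<close>
  (lemma \<open>clifford_gen_product\<close>).  The pointwise product that the library
  provides on \<open>_ ^ _\<close> plays no role; the Clifford product is \<open>\<star>\<close>.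
\<close>

type_synonym 'm clifford = "real ^ ('m set)"

text \<open>
  Sorting the word \<open>e\<^sub>A e\<^sub>B\<close> costs a factor \<open>-1\<close> for every pair \<open>a \<in> A\<close>, \<open>b \<in> B\<close> with \<open>b < a\<close>
  (transposition) and for every pair with \<open>b = a\<close> (because \<open>e\<^sub>a e\<^sub>a = -1\<close>).
\<close>

definition clifford_sign :: "'m::{finite,linorder} set \<Rightarrow> 'm set \<Rightarrow> real" where
  "clifford_sign A B = (\<Prod>a\<in>A. \<Prod>b\<in>B. if b \<le> a then - 1 else 1)"

definition clifford_mult ::
    "'m::{finite,linorder} clifford \<Rightarrow> 'm clifford \<Rightarrow> 'm clifford" (infixr "\<star>" 75) where
  "x \<star> y = (\<Sum>A\<in>UNIV. \<Sum>B\<in>UNIV. (x $ A * y $ B * clifford_sign A B) *\<^sub>R axis (sym_diff A B) 1)"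

definition clifford_one :: "'m::{finite,linorder} clifford" where
  "clifford_one = axis {} 1"

definition clifford_gen :: "'m::{finite,linorder} \<Rightarrow> 'm clifford" where
  "clifford_gen i = axis {i} 1"

lemma bilinear_clifford_mult: "bilinear (\<star>)"
  unfolding bilinear_def clifford_mult_def
  by (auto intro!: linearI simp: algebra_simps sum.distrib scaleR_sum_right)

lemma clifford_mult_linear_simps:
  fixes x y z :: "'a::{finite,linorder} clifford"
  shows "(x + y) \<star> z = x \<star> z + y \<star> z" "x \<star> (y + z) = x \<star> y + x \<star> z"
  "(x - y) \<star> z = x \<star> z - y \<star> z" "x \<star> (y - z) = x \<star> y - x \<star> z"
  "(c *\<^sub>R x) \<star> y = c *\<^sub>R (x \<star> y)" "x \<star> (c *\<^sub>R y) = c *\<^sub>R (x \<star> y)"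
  "(- x) \<star> y = - (x \<star> y)" "x \<star> (- y) = - (x \<star> y)"
  "0 \<star> y = 0" "x \<star> 0 = 0"
  using bilinear_clifford_mult[where ?'a = 'a]
  by (simp_all add: bilinear_ladd bilinear_radd bilinear_lsub bilinear_rsub bilinear_lmul
      bilinear_rmul bilinear_lneg bilinear_rneg bilinear_lzero bilinear_rzero)

lemma clifford_mult_sum:
  "(\<Sum>i\<in>I. f i) \<star> y = (\<Sum>i\<in>I. f i \<star> y)" "y \<star> (\<Sum>i\<in>I. f i) = (\<Sum>i\<in>I. y \<star> f i)"
  by (induction I rule: infinite_finite_induct) (auto simp: clifford_mult_linear_simps)

lemma clifford_mult_axis:
  "axis A 1 \<star> axis B 1 = clifford_sign A B *\<^sub>R (axis (sym_diff A B) 1 :: 'm::{finite,linorder} clifford)"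
proof -
  have "axis A 1 \<star> axis B 1 = (\<Sum>A'\<in>UNIV. \<Sum>B'\<in>UNIV. if A' = A \<and> B' = B
      then clifford_sign A B *\<^sub>R (axis (sym_diff A B) 1 :: 'm clifford) else 0)"
    unfolding clifford_mult_def by (intro sum.cong refl) (auto simp: axis_def)
  also have "\<dots> = (\<Sum>A'\<in>UNIV. if A' = A then \<Sum>B'\<in>UNIV. if B' = B
      then clifford_sign A B *\<^sub>R (axis (sym_diff A B) 1 :: 'm clifford) else 0 else 0)"
    by (intro sum.cong refl) auto
  finally show ?thesis by simp
qed

lemma prod_sym_diff_involutive:
  fixes g :: "'a::finite \<Rightarrow> real"
  assumes "\<And>a. g a * g a = 1"
  shows "prod g (sym_diff A B) = prod g A * prod g B"
proof -
  have "prod g A = prod g (A - B) * prod g (A \<inter> B)"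
    by (subst prod.union_disjoint[symmetric]) (auto intro!: prod.cong)
  moreover have "prod g B = prod g (B - A) * prod g (A \<inter> B)"
    by (subst prod.union_disjoint[symmetric]) (auto intro!: prod.cong)
  moreover have "prod g (sym_diff A B) = prod g (A - B) * prod g (B - A)"
    by (rule prod.union_disjoint) auto
  moreover have "prod g (A \<inter> B) * prod g (A \<inter> B) = 1"
    by (simp add: assms flip: prod.distrib)
  ultimately show ?thesis by (simp add: mult_ac)
qed

lemma clifford_sign_sym_diff:
  "clifford_sign (sym_diff A B) C = clifford_sign A C * clifford_sign B C"
  "clifford_sign C (sym_diff A B) = clifford_sign C A * clifford_sign C B"
proof -
  show "clifford_sign (sym_diff A B) C = clifford_sign A C * clifford_sign B C"
    unfolding clifford_sign_def
    by (rule prod_sym_diff_involutive) (auto intro!: prod.neutral simp flip: prod.distrib)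
  have "(\<Prod>b\<in>sym_diff A B. if b \<le> a then - 1 else 1) =
      (\<Prod>b\<in>A. if b \<le> a then - 1 else 1) * (\<Prod>b\<in>B. if b \<le> a then - 1 else (1::real))" for a
    by (rule prod_sym_diff_involutive) auto
  then show "clifford_sign C (sym_diff A B) = clifford_sign C A * clifford_sign C B"
    unfolding clifford_sign_def by (simp add: prod.distrib)
qed

lemma clifford_expansion:
  "(x :: 'm::{finite,linorder} clifford) = (\<Sum>A\<in>UNIV. x $ A *\<^sub>R axis A 1)"
  by (simp add: vec_eq_iff axis_def if_distrib cong: if_cong)

lemma clifford_mult_assoc:
  fixes x y z :: "'m::{finite,linorder} clifford"
  shows "(x \<star> y) \<star> z = x \<star> (y \<star> z)"
proof -
  have sd: "sym_diff (sym_diff A B) C = sym_diff A (sym_diff B C)" for A B C :: "'m set"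
    by auto
  have ax: "(axis A 1 \<star> axis B 1) \<star> axis C 1 = axis A 1 \<star> (axis B 1 \<star> axis C 1)"
    for A B C :: "'m set"
    by (simp add: clifford_mult_axis clifford_mult_linear_simps clifford_sign_sym_diff
        mult_ac del: Un_Diff) (use sd[of A B C] in argo)
  have 1: "(axis A 1 \<star> axis B 1) \<star> z = axis A 1 \<star> (axis B 1 \<star> z)" for A B :: "'m set"
    by (subst (1 2) clifford_expansion[of z])
      (simp only: clifford_mult_sum clifford_mult_linear_simps ax)
  have 2: "(axis A 1 \<star> y) \<star> z = axis A 1 \<star> (y \<star> z)" for A :: "'m set"
    by (subst (1 2) clifford_expansion[of y])
      (simp only: clifford_mult_sum clifford_mult_linear_simps 1)
  show ?thesis
    by (subst (1 2) clifford_expansion[of x])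
      (simp only: clifford_mult_sum clifford_mult_linear_simps 2)
qed

lemma clifford_mult_one [simp]: "clifford_one \<star> x = x" "x \<star> clifford_one = x"
proof -
  have "clifford_one \<star> axis A 1 = axis A 1" "axis A 1 \<star> clifford_one = axis A 1"
    for A :: "'a set"
    by (simp_all add: clifford_one_def clifford_mult_axis clifford_sign_def)
  then show "clifford_one \<star> x = x" "x \<star> clifford_one = x"
    by (subst (1 2) clifford_expansion[of x],
        simp only: clifford_mult_sum clifford_mult_linear_simps)+
qed

lemma clifford_gen_relation:
  "clifford_gen i \<star> clifford_gen j + clifford_gen j \<star> clifford_gen i
    = (if i = j then - 2 else 0) *\<^sub>R clifford_one"
proof (cases "i = j")
  case True
  then show ?thesis
    by (simp add: clifford_gen_def clifford_one_def clifford_mult_axis clifford_sign_def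
        flip: scaleR_2)
next
  case False
  then have "sym_diff {i} {j} = {i, j}" "sym_diff {j} {i} = {i, j}" by auto
  with False show ?thesis
    by (auto simp add: clifford_gen_def clifford_one_def clifford_mult_axis clifford_sign_def)
qed

lemma clifford_gen_product:
  "foldr (\<lambda>i b. clifford_gen i \<star> b) (sorted_list_of_set A) clifford_one = axis A 1"
proof -
  have "foldr (\<lambda>i b. clifford_gen i \<star> b) xs clifford_one = axis (set xs) 1"
    if "sorted_wrt (<) xs" for xs :: "'a list"
    using that
  proof (induction xs)
    case Nil
    then show ?case by (simp add: clifford_one_def)
  next
    case (Cons i xs)
    have "clifford_sign {i} (set xs) = 1"
      using Cons.prems by (force simp: clifford_sign_def intro!: prod.neutral)
    moreover have "sym_diff {i} (set xs) = insert i (set xs)"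
      using Cons.prems by auto
    ultimately show ?case
      using Cons by (simp add: clifford_gen_def clifford_mult_axis)
  qed
  from this[of "sorted_list_of_set A"] show ?thesis
    by (simp add: strict_sorted_list_of_set)
qed


section \<open>Paravectors and imaginary units\<close>

text \<open>\<open>(x\<^sub>0, x)\<close> stands for the point \<open>(x\<^sub>0, x\<^sub>1, \<dots>, x\<^sub>m)\<close> of \<open>\<real>\<^bsup>m+1\<^esup>\<close>.\<close>

type_synonym 'm paravector = "real \<times> (real ^ 'm)"

definition paravec :: "'m::{finite,linorder} paravector \<Rightarrow> 'm clifford" where
  "paravec x = fst x *\<^sub>R clifford_one + (\<Sum>i\<in>UNIV. (snd x $ i) *\<^sub>R clifford_gen i)"

definition imag_units :: "'m::finite paravector set" where
  "imag_units = {x. fst x = 0 \<and> (\<Sum>i\<in>UNIV. (snd x $ i)\<^sup>2) = 1}"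

lemma paravec_imag_unit_square:
  assumes "J \<in> imag_units"
  shows "paravec J \<star> paravec J = - clifford_one"
proof -
  let ?c = "\<lambda>i. snd J $ i"
  let ?S = "\<Sum>i\<in>UNIV. \<Sum>j\<in>UNIV. (?c i * ?c j) *\<^sub>R (clifford_gen i \<star> clifford_gen j)"
  have J: "paravec J = (\<Sum>i\<in>UNIV. ?c i *\<^sub>R clifford_gen i)"
    using assms by (simp add: paravec_def imag_units_def)
  have 1: "paravec J \<star> paravec J = ?S"
    unfolding J
    by (subst sum.swap)
      (simp add: clifford_mult_sum clifford_mult_linear_simps scaleR_sum_right mult.commute)
  have 2: "?S = (\<Sum>i\<in>UNIV. \<Sum>j\<in>UNIV. (?c i * ?c j) *\<^sub>R (clifford_gen j \<star> clifford_gen i))"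
    by (subst sum.swap) (simp add: mult.commute)
  have "?S + ?S = (\<Sum>i\<in>UNIV. \<Sum>j\<in>UNIV. (?c i * ?c j) *\<^sub>R
      (clifford_gen i \<star> clifford_gen j + clifford_gen j \<star> clifford_gen i))"
    by (subst (2) 2) (simp add: sum.distrib scaleR_add_right)
  also have "\<dots> = (\<Sum>i\<in>UNIV. - 2 * (?c i)\<^sup>2) *\<^sub>R clifford_one"
    by (simp add: clifford_gen_relation if_distrib if_distribR scaleR_sum_left power2_eq_square
        mult_ac cong: if_cong)
  also have "\<dots> = - 2 *\<^sub>R clifford_one"
    using assms by (simp add: imag_units_def sum_negf flip: sum_distrib_left)
  finally have "2 *\<^sub>R ?S = 2 *\<^sub>R (- clifford_one)"
    by (simp only: scaleR_2 scaleR_minus_left scaleR_minus_right)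
  then have "?S = - clifford_one"
    by (simp only: scaleR_cancel_left) simp
  then show ?thesis unfolding 1 .
qed


section \<open>Stem functions and slice functions\<close>

text \<open>The variables are indexed by a finite linearly ordered type \<open>'n\<close>, so \<open>n = CARD('n)\<close>.\<close>

definition conj_at :: "'n::finite \<Rightarrow> complex ^ 'n \<Rightarrow> complex ^ 'n" where
  "conj_at h z = (\<chi> l. if l = h then cnj (z $ l) else z $ l)"

definition symmetric_set :: "(complex ^ 'n::finite) set \<Rightarrow> bool" where
  "symmetric_set D \<longleftrightarrow> (\<forall>h. \<forall>z\<in>D. conj_at h z \<in> D)"

text \<open>The point \<open>(\<alpha>\<^sub>l + J\<^sub>l \<beta>\<^sub>l)\<^sub>l\<close> for \<open>z = (\<alpha>\<^sub>l + i \<beta>\<^sub>l)\<^sub>l\<close>.\<close>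

definition slice_point ::
    "complex ^ 'n::finite \<Rightarrow> 'm::finite paravector ^ 'n \<Rightarrow> 'm paravector ^ 'n" where
  "slice_point z J = (\<chi> l. (Re (z $ l), 0) + Im (z $ l) *\<^sub>R (J $ l))"

definition circularization ::
    "(complex ^ 'n::finite) set \<Rightarrow> ('m::finite paravector ^ 'n) set" where
  "circularization D = {slice_point z J | z J. z \<in> D \<and> (\<forall>l. J $ l \<in> imag_units)}"

text \<open>
  An element \<open>\<Sum>\<^sub>K \<epsilon>\<^sub>K a\<^sub>K\<close> of \<open>\<real>\<^sub>m \<otimes> \<real>\<^bsup>P(n)\<^esup>\<close> is represented by its family of coefficients
  \<open>a $ K = a\<^sub>K\<close>.
\<close>

type_synonym ('m, 'n) stem_value = "('m clifford) ^ ('n set)"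

definition stem_function ::
    "(complex ^ 'n::finite) set \<Rightarrow> (complex ^ 'n \<Rightarrow> ('m::finite, 'n) stem_value) \<Rightarrow> bool" where
  "stem_function D F \<longleftrightarrow>
    (\<forall>z\<in>D. \<forall>h K. F (conj_at h z) $ K = (if h \<in> K then - (F z $ K) else F z $ K))"

definition C1_on ::
    "'a::real_normed_vector set \<Rightarrow> ('a \<Rightarrow> 'b::real_normed_vector) \<Rightarrow> bool" where
  "C1_on D F \<longleftrightarrow> (\<exists>F' :: 'a \<Rightarrow> 'a \<Rightarrow>\<^sub>L 'b.
    (\<forall>z\<in>D. (F has_derivative blinfun_apply (F' z)) (at z)) \<and> continuous_on D F')"

definition bracket ::
    "'m::{finite,linorder} paravector ^ 'n::{finite,linorder} \<Rightarrow> 'n set \<Rightarrow> 'm clifford \<Rightarrow> 'm clifford"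
  where "bracket J K a = foldr (\<lambda>k b. paravec (J $ k) \<star> b) (sorted_list_of_set K) a"

text \<open>
  The function induced by \<open>F\<close> on \<open>circularization D\<close>; for a stem function on a symmetric
  set its value is independent of the representation of the point (lemma \<open>slice_fun_eq\<close>).
  Outside \<open>circularization D\<close> the value is unspecified.
\<close>

definition slice_fun ::
    "(complex ^ 'n::{finite,linorder}) set \<Rightarrow> (complex ^ 'n::{finite,linorder} \<Rightarrow> ('m, 'n) stem_value)
      \<Rightarrow> 'm::{finite,linorder} paravector ^ 'n::{finite,linorder} \<Rightarrow> 'm clifford" where
  "slice_fun D F x = (THE v. \<forall>z J. z \<in> D \<and> (\<forall>l. J $ l \<in> imag_units) \<and> x = slice_point z J
    \<longrightarrow> v = (\<Sum>K\<in>UNIV. bracket J K (F z $ K)))"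

lemma slice_point_nth_cases:
  assumes "J \<in> imag_units" "J' \<in> imag_units"
    and "(Re w, 0) + Im w *\<^sub>R J = (Re w', 0) + Im w' *\<^sub>R (J' :: 'm::{finite,linorder} paravector)"
  obtains "w' = w" "J' = J" | "w' = cnj w" "J' = - J" | "w' = w" "Im w = 0"
proof -
  have f: "fst J = 0" "fst J' = 0" using assms by (auto simp: imag_units_def)
  have re: "Re w = Re w'" and im: "Im w *\<^sub>R snd J = Im w' *\<^sub>R snd J'"
    using assms(3) f by (auto simp: prod_eq_iff)
  have n: "norm (snd J) = 1" "norm (snd J') = 1"
    using assms(1,2) by (auto simp: imag_units_def norm_vec_def L2_set_def)
  from arg_cong[OF im, of norm] have "\<bar>Im w\<bar> = \<bar>Im w'\<bar>" using n by simp
  then consider "Im w = 0" "Im w' = 0" | "Im w' = Im w" "Im w \<noteq> 0" | "Im w' = - Im w" "Im w \<noteq> 0"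
    by linarith
  then show thesis
  proof cases
    case 1
    then show thesis using re that(3) by (simp add: complex_eq_iff)
  next
    case 2
    with im have "snd J' = snd J" by simp
    then show thesis using 2 re f that(1) by (simp add: complex_eq_iff prod_eq_iff)
  next
    case 3
    with im have "Im w *\<^sub>R (snd J + snd J') = 0" by (simp add: scaleR_add_right)
    with 3 have "snd J' = - snd J" by (simp add: eq_neg_iff_add_eq_0 add.commute)
    then show thesis using 3 re f that(2) by (simp add: complex_eq_iff prod_eq_iff)
  qed
qed

lemma paravec_minus: "paravec (- x) = - paravec x"
  by (simp add: paravec_def sum_negf)

lemma bracket_minus: "bracket J K (- a) = - bracket J K a"
proof -
  have "foldr (\<lambda>k b. paravec (J $ k) \<star> b) xs (- a) = - foldr (\<lambda>k b. paravec (J $ k) \<star> b) xs a" for xs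
    by (induction xs) (auto simp: clifford_mult_linear_simps)
  then show ?thesis by (simp add: bracket_def)
qed

lemma bracket_zero: "bracket J K 0 = 0"
  using bracket_minus[of J K 0] by (simp add: eq_neg_iff_add_eq_0 flip: scaleR_2)

lemma bracket_cong:
  assumes "\<And>l. l \<in> K \<Longrightarrow> J' $ l = J $ l"
  shows "bracket J' K a = bracket J K a"
  unfolding bracket_def using assms by (intro foldr_cong) auto

lemma bracket_flip:
  assumes "h \<in> K" "J' $ h = - (J $ h)" "\<And>l. l \<noteq> h \<Longrightarrow> J' $ l = J $ l"
  shows "bracket J' K a = - bracket J K a"
proof -
  have "foldr (\<lambda>k b. paravec (J' $ k) \<star> b) xs a =
      (if h \<in> set xs then - foldr (\<lambda>k b. paravec (J $ k) \<star> b) xs a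
       else foldr (\<lambda>k b. paravec (J $ k) \<star> b) xs a)" if "distinct xs" for xs
    using that
  proof (induction xs)
    case (Cons k xs)
    then show ?case
      using assms(2,3)
      by (cases "k = h") (auto simp: clifford_mult_linear_simps paravec_minus)
  qed simp
  from this[of "sorted_list_of_set K"] show ?thesis
    using assms(1) by (simp add: bracket_def)
qed

lemma slice_step:
  assumes F: "stem_function D F" and z: "z \<in> D"
    and J: "J $ h \<in> imag_units" "J' $ h \<in> imag_units"
    and eq: "slice_point z J $ h = slice_point z' J' $ h"
    and other: "\<And>l. l \<noteq> h \<Longrightarrow> z' $ l = z $ l" "\<And>l. l \<noteq> h \<Longrightarrow> J' $ l = J $ l"
  shows "z' = z \<or> z' = conj_at h z"
    and "bracket J' K (F z' $ K) = bracket J K (F z $ K)"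
proof -
  have F': "F (conj_at h z) $ K = (if h \<in> K then - (F z $ K) else F z $ K)"
    using F z by (simp add: stem_function_def)
  have "(z' = z \<or> z' = conj_at h z) \<and> bracket J' K (F z' $ K) = bracket J K (F z $ K)"
    using J eq[unfolded slice_point_def vec_lambda_beta]
  proof (cases rule: slice_point_nth_cases)
    case 1
    then have "z' = z" "J' = J" using other by (metis vec_eq_iff)+
    then show ?thesis by simp
  next
    case 2
    then have z': "z' = conj_at h z" using other by (simp add: vec_eq_iff conj_at_def)
    show ?thesis
    proof (cases "h \<in> K")
      case True
      then show ?thesis
        using z' F' bracket_flip[of h K J' J] 2 other by (simp add: bracket_minus)
    next
      case False
      then have "bracket J' K a = bracket J K a" for a
        using other by (intro bracket_cong) metis
      then show ?thesis using z' F' False by simp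
    qed
  next
    case 3
    then have z': "z' = z" using other by (metis vec_eq_iff)
    have "conj_at h z = z" using 3 by (simp add: vec_eq_iff conj_at_def complex_eq_iff)
    show ?thesis
    proof (cases "h \<in> K")
      case True
      with F' \<open>conj_at h z = z\<close> have "F z $ K = - (F z $ K)" by simp
      then have "F z $ K = 0" by (simp add: eq_neg_iff_add_eq_0 flip: scaleR_2)
      then show ?thesis using z' by (simp add: bracket_zero)
    next
      case False
      then have "bracket J' K a = bracket J K a" for a
        using other by (intro bracket_cong) metis
      then show ?thesis using z' by simp
    qed
  qed
  then show "z' = z \<or> z' = conj_at h z" "bracket J' K (F z' $ K) = bracket J K (F z $ K)"
    by auto
qed

lemma bracket_well_defined:
  assumes D: "symmetric_set D" and F: "stem_function D F" and z: "z \<in> D"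
    and J: "\<And>l. J $ l \<in> imag_units" "\<And>l. J' $ l \<in> imag_units"
    and eq: "slice_point z J = slice_point z' J'"
  shows "bracket J' K (F z' $ K) = bracket J K (F z $ K)"
proof -
  define Z where "Z L = (\<chi> l. if l \<in> L then z' $ l else z $ l)" for L
  define I where "I L = (\<chi> l. if l \<in> L then J' $ l else J $ l)" for L
  have "Z L \<in> D \<and> bracket (I L) K (F (Z L) $ K) = bracket J K (F z $ K)" if "finite L" for L
    using that
  proof (induction L rule: finite_induct)
    case empty
    have "Z {} = z" "I {} = J" by (simp_all add: Z_def I_def vec_eq_iff)
    then show ?case using z by simp
  next
    case (insert h L)
    have nth: "slice_point z J $ h = slice_point z' J' $ h" using eq by simp
    have eq': "slice_point (Z L) (I L) $ h = slice_point (Z (insert h L)) (I (insert h L)) $ h"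
      using nth insert.hyps by (simp add: slice_point_def Z_def I_def)
    have o: "Z (insert h L) $ l = Z L $ l" "I (insert h L) $ l = I L $ l" if "l \<noteq> h" for l
      using that by (auto simp: Z_def I_def)
    have u: "I M $ h \<in> imag_units" for M using J by (simp add: I_def)
    note st = slice_step[OF F conjunct1[OF insert.IH] u u eq' o]
    have "Z (insert h L) \<in> D"
      using st(1) insert.IH D by (auto simp: symmetric_set_def)
    then show ?case using st(2) insert.IH by simp
  qed
  from this[of UNIV] show ?thesis by (simp add: Z_def I_def)
qed

lemma slice_fun_eq:
  assumes "symmetric_set D" "stem_function D F" "z \<in> D" "\<And>l. J $ l \<in> imag_units"
  shows "slice_fun D F (slice_point z J) = (\<Sum>K\<in>UNIV. bracket J K (F z $ K))"
  unfolding slice_fun_def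
proof (rule the_equality)
  show "\<forall>z' J'. z' \<in> D \<and> (\<forall>l. J' $ l \<in> imag_units) \<and> slice_point z J = slice_point z' J'
      \<longrightarrow> (\<Sum>K\<in>UNIV. bracket J K (F z $ K)) = (\<Sum>K\<in>UNIV. bracket J' K (F z' $ K))"
    using bracket_well_defined[OF assms(1,2,3)] assms(4) by (metis (no_types, lifting) sum.cong)
next
  fix v
  assume "\<forall>z' J'. z' \<in> D \<and> (\<forall>l. J' $ l \<in> imag_units) \<and> slice_point z J = slice_point z' J'
      \<longrightarrow> v = (\<Sum>K\<in>UNIV. bracket J' K (F z' $ K))"
  then show "v = (\<Sum>K\<in>UNIV. bracket J K (F z $ K))" using assms(3,4) by blast
qed


section \<open>Partial derivatives\<close>

definition dir_differentiable ::
    "('a::real_normed_vector \<Rightarrow> 'b::real_normed_vector) \<Rightarrow> 'a \<Rightarrow> 'a \<Rightarrow> bool" where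
  "dir_differentiable g v x \<longleftrightarrow> (\<lambda>t::real. g (x + t *\<^sub>R v)) differentiable (at 0)"

definition dir_deriv ::
    "('a::real_normed_vector \<Rightarrow> 'b::real_normed_vector) \<Rightarrow> 'a \<Rightarrow> 'a \<Rightarrow> 'b" where
  "dir_deriv g v x = vector_derivative (\<lambda>t::real. g (x + t *\<^sub>R v)) (at 0)"

abbreviation partial_alpha ::
    "'n::finite \<Rightarrow> (complex ^ 'n \<Rightarrow> 'b::real_normed_vector) \<Rightarrow> complex ^ 'n \<Rightarrow> 'b" where
  "partial_alpha h G \<equiv> dir_deriv G (axis h 1)"

abbreviation partial_beta ::
    "'n::finite \<Rightarrow> (complex ^ 'n \<Rightarrow> 'b::real_normed_vector) \<Rightarrow> complex ^ 'n \<Rightarrow> 'b" where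
  "partial_beta h G \<equiv> dir_deriv G (axis h \<i>)"

text \<open>The Laplacian in the \<open>h\<close>-th block of variables.\<close>

definition laplacian_at ::
    "'n::finite \<Rightarrow> ('a::euclidean_space ^ 'n \<Rightarrow> 'b::real_normed_vector) \<Rightarrow> 'a ^ 'n \<Rightarrow> 'b" where
  "laplacian_at h g x = (\<Sum>b\<in>Basis. dir_deriv (dir_deriv g (axis h b)) (axis h b) x)"

text \<open>
  Since \<open>vector_derivative\<close> is total, the existence of the second partial derivatives
  occurring in \<open>laplacian_at\<close> is a separate predicate.
\<close>

definition has_laplacian_at ::
    "'n::finite \<Rightarrow> ('a::euclidean_space ^ 'n \<Rightarrow> 'b::real_normed_vector) \<Rightarrow> 'a ^ 'n \<Rightarrow> bool" where
  "has_laplacian_at h g x \<longleftrightarrow> (\<forall>b\<in>Basis.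
    (\<forall>\<^sub>F t in nhds (0::real). dir_differentiable g (axis h b) (x + t *\<^sub>R axis h b)) \<and>
    dir_differentiable (dir_deriv g (axis h b)) (axis h b) x)"


section \<open>Slice derivatives\<close>

text \<open>
  \<open>\<J>\<^sub>h (\<Sum>\<^sub>K \<epsilon>\<^sub>K a\<^sub>K) = \<Sum>\<^bsub>h \<notin> K\<^esub> \<epsilon>\<^bsub>K \<union> {h}\<^esub> a\<^sub>K - \<Sum>\<^bsub>h \<in> K\<^esub> \<epsilon>\<^bsub>K - {h}\<^esub> a\<^sub>K\<close>, with coefficients collected.
\<close>

definition stem_J :: "'n::finite \<Rightarrow> ('m::finite, 'n) stem_value \<Rightarrow> ('m, 'n) stem_value" where
  "stem_J h a = (\<chi> K. if h \<in> K then a $ (K - {h}) else - (a $ insert h K))"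

definition stem_dbar ::
    "'n::finite \<Rightarrow> (complex ^ 'n \<Rightarrow> ('m::finite, 'n) stem_value)
      \<Rightarrow> complex ^ 'n \<Rightarrow> ('m, 'n) stem_value" where
  "stem_dbar h F z = (1/2) *\<^sub>R (partial_alpha h F z + stem_J h (partial_beta h F z))"

text \<open>\<open>\<partial>f / \<partial>x\<^sub>h\<^sup>c\<close> for \<open>f = slice_fun D F\<close>.\<close>

definition slice_dbar ::
    "(complex ^ 'n::{finite,linorder}) set \<Rightarrow> 'n \<Rightarrow> (complex ^ 'n::{finite,linorder} \<Rightarrow> ('m, 'n) stem_value)
      \<Rightarrow> 'm::{finite,linorder} paravector ^ 'n::{finite,linorder} \<Rightarrow> 'm clifford" where
  "slice_dbar D h F = slice_fun D (stem_dbar h F)"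

definition stem_spherical ::
    "'n::finite \<Rightarrow> (complex ^ 'n \<Rightarrow> ('m::finite, 'n) stem_value)
      \<Rightarrow> complex ^ 'n \<Rightarrow> ('m, 'n) stem_value" where
  "stem_spherical h F z =
    (\<chi> K. if h \<in> K then 0 else inverse (Im (z $ h)) *\<^sub>R (F z $ insert h K))"

text \<open>\<open>f'\<^bsub>s,h\<^esub>\<close> for \<open>f = slice_fun D F\<close>, a function on the points with \<open>x\<^sub>h \<notin> \<real>\<close>.\<close>

definition spherical_deriv ::
    "(complex ^ 'n::{finite,linorder}) set \<Rightarrow> 'n \<Rightarrow> (complex ^ 'n::{finite,linorder} \<Rightarrow> ('m, 'n) stem_value)
      \<Rightarrow> 'm::{finite,linorder} paravector ^ 'n::{finite,linorder} \<Rightarrow> 'm clifford" where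
  "spherical_deriv D h F = slice_fun {z \<in> D. Im (z $ h) \<noteq> 0} (stem_spherical h F)"

text \<open>\<open>a\<^sub>j\<^bsup>(k)\<^esup>\<close>; only used for \<open>1 \<le> j \<le> k\<close>, where no natural subtraction truncates.\<close>

definition a_coeff :: "nat \<Rightarrow> nat \<Rightarrow> real" where
  "a_coeff k j = fact (2 * k - j - 1) / (fact (j - 1) * fact (k - j) * (- 2) ^ (k - j))"

end

theory Submission
  imports Defs "HOL-Complex_Analysis.Cauchy_Integral_Formula"
begin

text \<open>
  The equation \<open>\<partial>f / \<partial>x\<^sub>h\<^sup>c = 0\<close> means that \<open>F\<^sub>K + i F\<^bsub>K \<union> {h}\<^esub>\<close> is holomorphic in the \<open>h\<close>-th variable,
  so \<open>v = F\<^bsub>K \<union> {h}\<^esub>\<close> is harmonic there, and so are all \<open>v\<^sub>j = \<partial>\<^sub>\<beta>\<^sup>j v\<close>.  Since \<open>[J\<^sub>K, \<cdot>]\<close> with \<open>h \<notin> K\<close>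
  does not involve \<open>x\<^sub>h\<close>, the function \<open>f'\<^bsub>s,h\<^esub>\<close> depends on \<open>x\<^sub>h\<close> only through \<open>\<alpha> + i\<beta>\<close>, where \<open>\<beta>\<close> is the
  norm of the imaginary part, and on such functions the Laplacian acts as
  \<open>\<partial>\<^sub>\<alpha>\<^sup>2 + \<partial>\<^sub>\<beta>\<^sup>2 + (m - 1) \<beta>\<^sup>-\<^sup>1 \<partial>\<^sub>\<beta>\<close>.  Hence
  \<open>\<Delta> (\<beta>\<^sup>q v\<^sub>j) = q (q + m - 2) \<beta>\<^bsup>q-2\<^esup> v\<^sub>j + (2q + m - 1) \<beta>\<^bsup>q-1\<^esup> v\<^bsub>j+1\<^esub>\<close>,
  and induction on \<open>k\<close> starting from \<open>\<beta>\<^sup>-\<^sup>1 v\<close> yields the second formula.  The first one follows by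
  substituting \<open>v\<^sub>j = \<beta> u\<^sub>j + j u\<^bsub>j-1\<^esub>\<close> for \<open>u\<^sub>j = \<partial>\<^sub>\<beta>\<^sup>j (v / \<beta>)\<close>.
\<close>

section \<open>Derivatives in the direction of one variable\<close>

text \<open>Freezes all variables except the \<open>h\<close>-th:
  \<open>\<lambda>p. g (upd_at h x p)\<close> is a function of one variable, to which ordinary
  calculus applies.\<close>

definition upd_at :: "'n::finite \<Rightarrow> 'a ^ 'n \<Rightarrow> 'a \<Rightarrow> 'a ^ 'n" where
  "upd_at h x p = (\<chi> l. if l = h then p else x $ l)"

lemma upd_at_nth [simp]: "upd_at h x p $ l = (if l = h then p else x $ l)"
  by (simp add: upd_at_def)

lemma upd_at_same [simp]: "upd_at h x (x $ h) = x"
  by (simp add: vec_eq_iff)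

lemma upd_at_add_axis:
  "upd_at h x p + t *\<^sub>R axis h v = upd_at h x (p + t *\<^sub>R (v :: 'a::real_vector))"
  by (simp add: vec_eq_iff axis_def)

lemma upd_at_has_derivative: "(upd_at h x has_derivative axis h) (at (p :: 'a::euclidean_space))"
proof -
  have *: "upd_at h x = (\<lambda>q. upd_at h x 0 + axis h q)"
    by (auto simp: fun_eq_iff vec_eq_iff axis_def)
  have "bounded_linear (axis h :: 'a \<Rightarrow> 'a ^ _)"
    by (intro linear_conv_bounded_linear[THEN iffD1] linearI) (auto simp: vec_eq_iff axis_def)
  from has_derivative_add[OF has_derivative_const bounded_linear_imp_has_derivative[OF this]]
  show ?thesis by (subst *) simp
qed

lemma continuous_on_upd_at: "continuous_on A (upd_at h (x :: 'a::euclidean_space ^ 'n))"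
  by (meson upd_at_has_derivative has_derivative_continuous continuous_at_imp_continuous_on)

lemma eventually_line_mem:
  fixes p v :: "'a::real_normed_vector"
  assumes "open U" "p \<in> U"
  shows "\<forall>\<^sub>F t in nhds (0::real). p + t *\<^sub>R v \<in> U"
proof -
  have "((\<lambda>t::real. p + t *\<^sub>R v) \<longlongrightarrow> p + 0 *\<^sub>R v) (nhds 0)"
    by (intro tendsto_intros filterlim_ident)
  from topological_tendstoD[OF this assms(1)] assms(2) show ?thesis by simp
qed

lemma dir_deriv_has_derivative:
  assumes "(g has_derivative g') (at x)"
  shows "dir_differentiable g v x" "dir_deriv g v x = g' v"
proof -
  have lin: "linear g'" using assms has_derivative_linear by blast
  have "((\<lambda>t::real. x + t *\<^sub>R v) has_derivative (\<lambda>t. t *\<^sub>R v)) (at 0)"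
    by (auto intro!: derivative_eq_intros)
  moreover have "(g has_derivative g') (at (x + 0 *\<^sub>R v))" using assms by simp
  ultimately have "((\<lambda>t. g (x + t *\<^sub>R v)) has_derivative (\<lambda>t. g' (t *\<^sub>R v))) (at 0)"
    using diff_chain_at[of "\<lambda>t::real. x + t *\<^sub>R v" _ 0 g g'] by (simp add: o_def)
  then have *: "((\<lambda>t. g (x + t *\<^sub>R v)) has_vector_derivative g' v) (at 0)"
    using lin by (simp add: has_vector_derivative_def linear_cmul)
  show "dir_deriv g v x = g' v"
    unfolding dir_deriv_def by (rule vector_derivative_at[OF *])
  show "dir_differentiable g v x"
    unfolding dir_differentiable_def
    using * has_vector_derivative_def differentiable_def by blast
qed

text \<open>For small \<open>t\<close> the line \<open>p + t *\<^sub>R v\<close> stays in the open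
  set \<open>U\<close>, where \<open>g\<close> restricted to the \<open>h\<close>-th variable is
  \<open>G\<close>. Thus a derivative of the one-variable function \<open>G\<close> decides the
  directional derivative of \<open>g\<close>.\<close>

lemma dir_deriv_upd_at:
  fixes g :: "'a::real_normed_vector ^ 'n::finite \<Rightarrow> 'b::real_normed_vector"
  assumes U: "open U" "p \<in> U" and g: "\<And>q. q \<in> U \<Longrightarrow> g (upd_at h x q) = G q"
    and G: "(G has_derivative G') (at p)"
  shows "dir_differentiable g (axis h v) (upd_at h x p)"
    and "dir_deriv g (axis h v) (upd_at h x p) = G' v"
proof -
  have ev: "\<forall>\<^sub>F t in nhds 0. G (p + t *\<^sub>R v) = g (upd_at h x p + t *\<^sub>R axis h v)"
    using eventually_line_mem[OF U, of v]
    by eventually_elim (simp add: upd_at_add_axis g)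
  then have at: "\<forall>\<^sub>F t in at 0. G (p + t *\<^sub>R v) = g (upd_at h x p + t *\<^sub>R axis h v)"
    using eventually_nhds_conv_at by blast
  have 0: "G p = g (upd_at h x p)" using g U by simp
  note D = dir_deriv_has_derivative[OF G, of v]
  obtain L where L: "((\<lambda>t. G (p + t *\<^sub>R v)) has_derivative L) (at 0)"
    using D(1) by (auto simp: dir_differentiable_def differentiable_def)
  have "((\<lambda>t. g (upd_at h x p + t *\<^sub>R axis h v)) has_derivative L) (at 0)"
    by (rule has_derivative_transform_eventually[OF L at]) (auto simp: 0)
  then show "dir_differentiable g (axis h v) (upd_at h x p)"
    by (auto simp: dir_differentiable_def differentiable_def)
  have "dir_deriv g (axis h v) (upd_at h x p) = dir_deriv G v p"
    unfolding dir_deriv_def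
    by (rule vector_derivative_cong_eq[symmetric]) (use ev in auto)
  then show "dir_deriv g (axis h v) (upd_at h x p) = G' v" using D(2) by simp
qed

text \<open>\<open>dir_deriv_upd_at\<close> is used twice: first at every point of \<open>U\<close>,
  so that the first derivatives are known near \<open>p\<close>, and then at \<open>p\<close> with
  these derivatives in place of \<open>g\<close>.\<close>

lemma laplacian_at_upd_at:
  fixes g :: "'a::euclidean_space ^ 'n::finite \<Rightarrow> 'b::real_normed_vector"
  assumes U: "open U" "p \<in> U" and g: "\<And>q. q \<in> U \<Longrightarrow> g (upd_at h x q) = G q"
    and G: "\<And>q. q \<in> U \<Longrightarrow> (G has_derivative G1 q) (at q)"
    and G1: "\<And>b. b \<in> Basis \<Longrightarrow> ((\<lambda>q. G1 q b) has_derivative G2 b) (at p)"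
  shows "has_laplacian_at h g (upd_at h x p)"
    and "laplacian_at h g (upd_at h x p) = (\<Sum>b\<in>Basis. G2 b b)"
proof -
  have 1: "dir_differentiable g (axis h v) (upd_at h x q)"
    "dir_deriv g (axis h v) (upd_at h x q) = G1 q v" if "q \<in> U" for q v
    using dir_deriv_upd_at[OF U(1) that g G[OF that]] by auto
  have 2: "dir_differentiable (dir_deriv g (axis h b)) (axis h b) (upd_at h x p)"
    "dir_deriv (dir_deriv g (axis h b)) (axis h b) (upd_at h x p) = G2 b b" if "b \<in> Basis" for b
    using dir_deriv_upd_at[OF U 1(2) G1[OF that]] by auto
  show "laplacian_at h g (upd_at h x p) = (\<Sum>b\<in>Basis. G2 b b)"
    unfolding laplacian_at_def by (intro sum.cong refl 2)
  show "has_laplacian_at h g (upd_at h x p)"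
    unfolding has_laplacian_at_def
  proof (intro ballI conjI 2)
    fix b :: 'a
    show "\<forall>\<^sub>F t in nhds 0. dir_differentiable g (axis h b) (upd_at h x p + t *\<^sub>R axis h b)"
      using eventually_line_mem[OF U, of b] by eventually_elim (simp add: upd_at_add_axis 1)
  qed
qed

section \<open>The Laplacian of axially symmetric functions\<close>

definition half_plane_coord :: "real \<times> 'c::real_normed_vector \<Rightarrow> complex" where
  "half_plane_coord p = Complex (fst p) (norm (snd p))"

text \<open>The normal form \<open>r^q A(x_0 + i r)\<close> in which every iterated Laplacian is
  expressed, where \<open>r\<close> is the norm of the imaginary part. The exponent is an integer
  since negative powers occur.\<close>

definition radial ::
    "(complex \<Rightarrow> 'b::real_normed_vector) \<Rightarrow> int \<Rightarrow> real \<times> 'c::real_normed_vector \<Rightarrow> 'b" where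
  "radial A q p = (norm (snd p) powi q) *\<^sub>R A (half_plane_coord p)"

text \<open>Product and chain rule, where \<open>B\<close> and \<open>C\<close> are the partial
  derivatives of \<open>A\<close> in \<alpha> and \<beta>. The derivative of \<open>r\<close> is
  \<open>(snd p \<bullet> snd d) / r\<close>; absorbing \<open>1/r\<close> into the exponents
  expresses the result by radial functions again, so it can be differentiated once more.\<close>

lemma radial_has_derivative:
  fixes p :: "real \<times> 'c::euclidean_space"
  assumes A: "(A has_derivative (\<lambda>d. Re d *\<^sub>R B (half_plane_coord p) + Im d *\<^sub>R C (half_plane_coord p)))
      (at (half_plane_coord p))"
    and p: "snd p \<noteq> 0"
  shows "(radial A q has_derivative (\<lambda>d. fst d *\<^sub>R radial B q p
    + (snd p \<bullet> snd d) *\<^sub>R (of_int q *\<^sub>R radial A (q - 2) p + radial C (q - 1) p))) (at p)"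
proof -
  define r where "r = norm (snd p)"
  have r: "r \<noteq> 0" using p by (simp add: r_def)
  have n: "((\<lambda>p. norm (snd p)) has_derivative (\<lambda>d. snd d \<bullet> sgn (snd p))) (at p)"
    using diff_chain_at[OF has_derivative_snd[OF has_derivative_ident] has_derivative_norm[OF p]]
    by (simp add: o_def)
  have e: "half_plane_coord = (\<lambda>p::real \<times> 'c. of_real (fst p) + \<i> * of_real (norm (snd p)))"
    by (simp add: fun_eq_iff half_plane_coord_def complex_eq_iff)
  have hp: "(half_plane_coord has_derivative (\<lambda>d. of_real (fst d) + \<i> * of_real (snd d \<bullet> sgn (snd p))))
      (at p)"
    unfolding e by (auto intro!: derivative_eq_intros n has_derivative_of_real)
  have Ah: "((\<lambda>p. A (half_plane_coord p)) has_derivative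
      (\<lambda>d. fst d *\<^sub>R B (half_plane_coord p) + (snd d \<bullet> sgn (snd p)) *\<^sub>R C (half_plane_coord p))) (at p)"
    using diff_chain_at[OF hp A] by (simp add: o_def)
  have "((\<lambda>r::real. r powi q) has_derivative (\<lambda>y. y * (of_int q * r powi (q - 1)))) (at r)"
    using r by (auto intro!: derivative_eq_intros)
  from diff_chain_at[OF n this[unfolded r_def]]
  have P: "((\<lambda>p. norm (snd p) powi q) has_derivative
      (\<lambda>d. (snd d \<bullet> sgn (snd p)) * (of_int q * r powi (q - 1)))) (at p)"
    by (simp add: o_def r_def)
  have s: "snd d \<bullet> sgn (snd p) = (snd p \<bullet> snd d) / r" for d :: "real \<times> 'c"
    by (simp add: sgn_div_norm r_def inner_commute divide_inverse)
  have "(radial A q has_derivative (\<lambda>d. (r powi q) *\<^sub>R (fst d *\<^sub>R B (half_plane_coord p)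
      + (snd d \<bullet> sgn (snd p)) *\<^sub>R C (half_plane_coord p))
      + ((snd d \<bullet> sgn (snd p)) * (of_int q * r powi (q - 1))) *\<^sub>R A (half_plane_coord p))) (at p)"
    unfolding radial_def[abs_def] using has_derivative_scaleR[OF P Ah] by (simp add: r_def)
  also have "(\<lambda>d. (r powi q) *\<^sub>R (fst d *\<^sub>R B (half_plane_coord p)
      + (snd d \<bullet> sgn (snd p)) *\<^sub>R C (half_plane_coord p))
      + ((snd d \<bullet> sgn (snd p)) * (of_int q * r powi (q - 1))) *\<^sub>R A (half_plane_coord p))
    = (\<lambda>d. fst d *\<^sub>R radial B q p
    + (snd p \<bullet> snd d) *\<^sub>R (of_int q *\<^sub>R radial A (q - 2) p + radial C (q - 1) p))"
  proof
    fix d :: "real \<times> 'c"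
    have "r powi (q - 2) = r powi (q - 1) / r" "r powi (q - 1) = r powi q / r"
      using r by (simp_all add: power_int_diff power2_eq_square)
    then show "(r powi q) *\<^sub>R (fst d *\<^sub>R B (half_plane_coord p)
      + (snd d \<bullet> sgn (snd p)) *\<^sub>R C (half_plane_coord p))
      + ((snd d \<bullet> sgn (snd p)) * (of_int q * r powi (q - 1))) *\<^sub>R A (half_plane_coord p)
      = fst d *\<^sub>R radial B q p
    + (snd p \<bullet> snd d) *\<^sub>R (of_int q *\<^sub>R radial A (q - 2) p + radial C (q - 1) p)"
      by (simp add: radial_def s r_def[symmetric] scaleR_add_right mult_ac)
  qed
  finally show ?thesis .
qed

text \<open>
  A harmonic function is differentiated as often as needed in the direction of the imaginary
  axis: \<open>V j\<close> stands for its \<open>j\<close>-th derivative in \<open>\<beta>\<close>, and \<open>W j\<close> for the derivative of \<open>V j\<close>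
  in \<open>\<alpha>\<close>.
\<close>

definition harmonic_tower ::
    "complex set \<Rightarrow> (nat \<Rightarrow> complex \<Rightarrow> 'b::real_normed_vector) \<Rightarrow> (nat \<Rightarrow> complex \<Rightarrow> 'b) \<Rightarrow> bool" where
  "harmonic_tower S V W \<longleftrightarrow> open S \<and> (\<forall>\<zeta>\<in>S. \<forall>j.
    (V j has_derivative (\<lambda>d. Re d *\<^sub>R W j \<zeta> + Im d *\<^sub>R V (Suc j) \<zeta>)) (at \<zeta>) \<and>
    (W j has_derivative (\<lambda>d. Re d *\<^sub>R (- V (Suc (Suc j)) \<zeta>) + Im d *\<^sub>R W (Suc j) \<zeta>)) (at \<zeta>))"

section \<open>The Laplacian split into the real coordinate and the imaginary part\<close>

lemma sum_Basis_prod_real: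
  fixes \<phi> :: "real \<times> 'c::euclidean_space \<Rightarrow> 'b::comm_monoid_add"
  shows "(\<Sum>b\<in>Basis. \<phi> b) = \<phi> (1, 0) + (\<Sum>e\<in>Basis. \<phi> (0, e))"
proof -
  have "sum \<phi> Basis = sum \<phi> (insert (1, 0) (Pair 0 ` Basis))"
    by (rule arg_cong[where f = "sum \<phi>"]) (auto simp: Basis_prod_def)
  moreover have "(1, 0) \<notin> (Pair 0 ` Basis :: (real \<times> 'c) set)" by auto
  moreover have "(\<Sum>b\<in>Pair 0 ` Basis. \<phi> b) = (\<Sum>e\<in>Basis. \<phi> (0, e))"
    by (subst sum.reindex) (auto simp: inj_on_def)
  ultimately show ?thesis by simp
qed

lemma sum_Basis_inner_square: "(\<Sum>e\<in>Basis. (y \<bullet> e)\<^sup>2) = (norm (y :: 'c::euclidean_space))\<^sup>2"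
  by (subst power2_norm_eq_inner, subst euclidean_inner) (simp add: power2_eq_square)

lemma norm_square_radial:
  fixes p :: "real \<times> 'c::real_normed_vector"
  assumes "snd p \<noteq> 0"
  shows "(norm (snd p))\<^sup>2 *\<^sub>R radial A q p = radial A (q + 2) p"
  using assms by (simp add: radial_def power_int_add mult.commute)

text \<open>Points with \<open>snd p = 0\<close> are excluded because the norm and its negative
  powers are singular there.\<close>

definition axial_domain :: "complex set \<Rightarrow> (real \<times> 'c::real_normed_vector) set" where
  "axial_domain S = {p. snd p \<noteq> 0 \<and> half_plane_coord p \<in> S}"

lemma continuous_half_plane_coord: "continuous_on A (half_plane_coord :: real \<times> 'c::real_normed_vector \<Rightarrow> _)"
proof -
  have e: "half_plane_coord = (\<lambda>p::real \<times> 'c. of_real (fst p) + \<i> * of_real (norm (snd p)))"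
    by (simp add: fun_eq_iff half_plane_coord_def complex_eq_iff)
  show ?thesis unfolding e by (intro continuous_intros)
qed

lemma open_axial_domain:
  assumes "open S"
  shows "open (axial_domain S :: (real \<times> 'c::real_normed_vector) set)"
proof -
  have "open (half_plane_coord -` S :: (real \<times> 'c) set)"
    by (rule open_vimage[OF assms continuous_half_plane_coord])
  moreover have "open {p :: real \<times> 'c. snd p \<noteq> 0}"
    by (intro open_Collect_neq continuous_intros)
  ultimately have "open ({p :: real \<times> 'c. snd p \<noteq> 0} \<inter> half_plane_coord -` S)" by blast
  then show ?thesis by (simp add: axial_domain_def Collect_conj_eq vimage_def)
qed

text \<open>Each summand yields multiples of \<open>V j\<close>, \<open>V (Suc j)\<close> and
  \<open>V (Suc (Suc j))\<close>; the last kind cancels between the \<alpha>- and \<beta>-directions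
  because \<open>V j\<close> is harmonic. The statement covers linear combinations given on the
  whole \<open>axial_domain S\<close>, so that it can be iterated.\<close>

lemma laplacian_radial:
  fixes g :: "(real \<times> 'c::euclidean_space) ^ 'n::finite \<Rightarrow> 'b::real_normed_vector"
    and c :: "nat \<Rightarrow> real" and q :: "nat \<Rightarrow> int"
  assumes VW: "harmonic_tower S V W" and p: "p \<in> axial_domain S"
    and g: "\<And>p. p \<in> axial_domain S \<Longrightarrow> g (upd_at h x p) = (\<Sum>j\<in>I. c j *\<^sub>R radial (V j) (q j) p)"
  shows "has_laplacian_at h g (upd_at h x p)"
    and "laplacian_at h g (upd_at h x p) =
      (\<Sum>j\<in>I. (c j * real_of_int (q j) * (real_of_int (q j) + real DIM('c) - 2)) *\<^sub>R radial (V j) (q j - 2) p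
        + (c j * (2 * real_of_int (q j) + real DIM('c) - 1)) *\<^sub>R radial (V (Suc j)) (q j - 1) p)"
proof -
  have dV: "(radial (V j) k has_derivative (\<lambda>d. fst d *\<^sub>R radial (W j) k p
    + (snd p \<bullet> snd d) *\<^sub>R (of_int k *\<^sub>R radial (V j) (k - 2) p + radial (V (Suc j)) (k - 1) p))) (at p)"
    if "p \<in> axial_domain S" for j k and p :: "real \<times> 'c"
    using that VW by (intro radial_has_derivative) (auto simp: axial_domain_def harmonic_tower_def)
  have dW: "(radial (W j) k has_derivative (\<lambda>d. fst d *\<^sub>R radial (\<lambda>\<zeta>. - V (Suc (Suc j)) \<zeta>) k p
    + (snd p \<bullet> snd d) *\<^sub>R (of_int k *\<^sub>R radial (W j) (k - 2) p + radial (W (Suc j)) (k - 1) p))) (at p)"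
    for j k
    using p VW by (intro radial_has_derivative) (auto simp: axial_domain_def harmonic_tower_def)
  \<comment> \<open>\<open>E j k\<close> is \<open>1/r\<close> times the radial derivative of
    \<open>radial (V j) k\<close>, and \<open>E' j k\<close> is its derivative at
    \<open>p\<close>.\<close>
  define E where "E j k p = of_int k *\<^sub>R radial (V j) (k - 2) p + radial (V (Suc j)) (k - 1) p"
    for j k and p :: "real \<times> 'c"
  define E' where "E' j k d = of_int k *\<^sub>R (fst d *\<^sub>R radial (W j) (k - 2) p
        + (snd p \<bullet> snd d) *\<^sub>R E j (k - 2) p)
      + (fst d *\<^sub>R radial (W (Suc j)) (k - 1) p + (snd p \<bullet> snd d) *\<^sub>R E (Suc j) (k - 1) p)"
    for j k d
  have dE: "(E j k has_derivative E' j k) (at p)" for j k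
    unfolding E_def[abs_def] E'_def[abs_def]
    by (intro has_derivative_add has_derivative_scaleR_right dV p)
  define G1 where "G1 p d = (\<Sum>j\<in>I. c j *\<^sub>R (fst d *\<^sub>R radial (W j) (q j) p + (snd p \<bullet> snd d) *\<^sub>R E j (q j) p))"
    for p d
  \<comment> \<open>In \<open>G2 b d\<close> the first differentiation is in direction
    \<open>b\<close> and the second in direction \<open>d\<close>.\<close>
  define G2 where "G2 b d = (\<Sum>j\<in>I. c j *\<^sub>R (fst b *\<^sub>R
      (fst d *\<^sub>R radial (\<lambda>\<zeta>. - V (Suc (Suc j)) \<zeta>) (q j) p
    + (snd p \<bullet> snd d) *\<^sub>R (of_int (q j) *\<^sub>R radial (W j) (q j - 2) p + radial (W (Suc j)) (q j - 1) p))
     + ((snd p \<bullet> snd b) *\<^sub>R E' j (q j) d + (snd d \<bullet> snd b) *\<^sub>R E j (q j) p)))"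
    for b d :: "real \<times> 'c"
  have G: "((\<lambda>p. \<Sum>j\<in>I. c j *\<^sub>R radial (V j) (q j) p) has_derivative G1 p) (at p)"
    if "p \<in> axial_domain S" for p
    unfolding G1_def E_def
    by (intro has_derivative_sum has_derivative_scaleR_right dV that)
  have i: "((\<lambda>p::real \<times> 'c. snd p \<bullet> snd b) has_derivative (\<lambda>d. snd d \<bullet> snd b)) (at p)" for b :: "real \<times> 'c"
    by (auto intro!: derivative_eq_intros)
  have G1': "((\<lambda>p. G1 p b) has_derivative G2 b) (at p)" for b
    unfolding G1_def G2_def
    by (intro has_derivative_sum has_derivative_scaleR_right has_derivative_add has_derivative_scaleR i dE dW)
  have S: "open S" using VW by (simp add: harmonic_tower_def)
  note L = laplacian_at_upd_at[OF open_axial_domain[OF S] p g G G1']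
  show "has_laplacian_at h g (upd_at h x p)" by (rule L(1))
  have sp: "snd p \<noteq> 0" using p by (simp add: axial_domain_def)
  have sum_e: "(\<Sum>e\<in>Basis. (snd p \<bullet> e)\<^sup>2 *\<^sub>R (X :: 'b)) = (norm (snd p))\<^sup>2 *\<^sub>R X" for X
    by (simp add: sum_Basis_inner_square flip: scaleR_sum_left)
  \<comment> \<open>The contribution of one summand. The subtracted term is the second derivative in
    the real coordinate, where \<open>V j\<close> differentiated twice in \<alpha> gives
    \<open>- V (Suc (Suc j))\<close>.\<close>
  have one: "(\<Sum>e\<in>Basis. (snd p \<bullet> e) *\<^sub>R E' j k (0, e) + (e \<bullet> e) *\<^sub>R E j k p)
      - radial (V (Suc (Suc j))) k p
      = (real_of_int k * (real_of_int k + real DIM('c) - 2)) *\<^sub>R radial (V j) (k - 2) p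
        + (2 * real_of_int k + real DIM('c) - 1) *\<^sub>R radial (V (Suc j)) (k - 1) p" for j k
  proof -
    have "(\<Sum>e\<in>Basis. (snd p \<bullet> e) *\<^sub>R E' j k (0, e) + (e \<bullet> e) *\<^sub>R E j k p)
        = (\<Sum>e\<in>Basis. (snd p \<bullet> e)\<^sup>2 *\<^sub>R (of_int k *\<^sub>R E j (k - 2) p + E (Suc j) (k - 1) p) + E j k p)"
      by (intro sum.cong refl)
        (auto simp: E'_def scaleR_add_right power2_eq_square mult_ac inner_same_Basis)
    \<comment> \<open>The squares of the coordinates add up to \<open>r^2\<close>, which raises
      exponents by two; the remaining summand is constant and is counted \<open>DIM('c)\<close>
      times.\<close>
    also have "\<dots> = (norm (snd p))\<^sup>2 *\<^sub>R (of_int k *\<^sub>R E j (k - 2) p + E (Suc j) (k - 1) p)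
        + real DIM('c) *\<^sub>R E j k p"
      by (simp only: sum.distrib sum_e sum_constant_scaleR)
    also have "(norm (snd p))\<^sup>2 *\<^sub>R (of_int k *\<^sub>R E j (k - 2) p + E (Suc j) (k - 1) p)
       = of_int k *\<^sub>R (of_int (k - 2) *\<^sub>R radial (V j) (k - 2) p + radial (V (Suc j)) (k - 1) p)
         + (of_int (k - 1) *\<^sub>R radial (V (Suc j)) (k - 1) p + radial (V (Suc (Suc j))) k p)"
      unfolding E_def scaleR_add_right scaleR_left_commute[of "(norm (snd p))\<^sup>2"] norm_square_radial[OF sp]
      by (simp add: algebra_simps)
    finally have *: "(\<Sum>e\<in>Basis. (snd p \<bullet> e) *\<^sub>R E' j k (0, e) + (e \<bullet> e) *\<^sub>R E j k p)
      = of_int k *\<^sub>R (of_int (k - 2) *\<^sub>R radial (V j) (k - 2) p + radial (V (Suc j)) (k - 1) p)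
        + (of_int (k - 1) *\<^sub>R radial (V (Suc j)) (k - 1) p + radial (V (Suc (Suc j))) k p)
        + real DIM('c) *\<^sub>R E j k p" .
    have two: "(a * 2) *\<^sub>R X = a *\<^sub>R X + a *\<^sub>R X" for a and X :: 'b
      by (simp only: mult_2_right scaleR_add_left)
    show ?thesis
      unfolding * by (simp add: E_def algebra_simps two)
  qed
  have "laplacian_at h g (upd_at h x p) = G2 (1, 0) (1, 0) + (\<Sum>e\<in>Basis. G2 (0, e) (0, e))"
    using L(2) by (simp add: sum_Basis_prod_real)
  also have "(\<Sum>e\<in>Basis. G2 (0, e) (0, e)) = (\<Sum>j\<in>I. c j *\<^sub>R
      (\<Sum>e\<in>Basis. (snd p \<bullet> e) *\<^sub>R E' j (q j) (0, e) + (e \<bullet> e) *\<^sub>R E j (q j) p))"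
    unfolding G2_def by (subst sum.swap) (simp add: scaleR_sum_right)
  also have "G2 (1, 0) (1, 0) = (\<Sum>j\<in>I. c j *\<^sub>R (- radial (V (Suc (Suc j))) (q j) p))"
    unfolding G2_def by (simp add: radial_def)
  also have "(\<Sum>j\<in>I. c j *\<^sub>R (- radial (V (Suc (Suc j))) (q j) p)) + (\<Sum>j\<in>I. c j *\<^sub>R
      (\<Sum>e\<in>Basis. (snd p \<bullet> e) *\<^sub>R E' j (q j) (0, e) + (e \<bullet> e) *\<^sub>R E j (q j) p))
    = (\<Sum>j\<in>I. c j *\<^sub>R ((\<Sum>e\<in>Basis. (snd p \<bullet> e) *\<^sub>R E' j (q j) (0, e) + (e \<bullet> e) *\<^sub>R E j (q j) p)
      - radial (V (Suc (Suc j))) (q j) p))"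
    by (simp only: sum.distrib[symmetric] scaleR_add_right[symmetric] add.commute[of "- _"]
        diff_conv_add_uminus)
  finally show "laplacian_at h g (upd_at h x p) =
      (\<Sum>j\<in>I. (c j * real_of_int (q j) * (real_of_int (q j) + real DIM('c) - 2)) *\<^sub>R radial (V j) (q j - 2) p
        + (c j * (2 * real_of_int (q j) + real DIM('c) - 1)) *\<^sub>R radial (V (Suc j)) (q j - 1) p)"
    unfolding one by (simp only: scaleR_add_right scaleR_scaleR mult.assoc)
qed

section \<open>Iterated Laplacians and the coefficients\<close>

text \<open>Writing the upper index as \<open>Suc (j + n)\<close> removes every natural subtraction;
  the identities below are proved in the parameters \<open>j\<close> and \<open>n\<close>.\<close>

lemma a_coeff_eq: "a_coeff (Suc (j + n)) (Suc j) = fact (j + 2 * n) / (fact j * fact n * (- 2) ^ n)"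
proof -
  have "2 * Suc (j + n) - Suc j - 1 = j + 2 * n" "Suc (j + n) - Suc j = n" by simp_all
  then show ?thesis by (simp add: a_coeff_def)
qed

lemma a_coeff_top: "a_coeff (Suc k) (Suc k) = 1"
  using a_coeff_eq[of k 0] by simp

lemma a_coeff_Suc_eq:
  "a_coeff (Suc (Suc (j + n))) (Suc j)
    = a_coeff (Suc (j + n)) (Suc j) * ((real j + 2 * n + 1) * (real j + 2 * n + 2) / (- 2 * (real n + 1)))"
proof -
  have "fact (j + 2 * Suc n) = fact (j + 2 * n) * ((real j + 2 * n + 1) * (real j + 2 * n + 2))"
    by (simp add: algebra_simps)
  moreover have "fact (Suc n) = (real n + 1) * fact n" by simp
  moreover have "a_coeff (Suc (Suc (j + n))) (Suc j)
      = fact (j + 2 * Suc n) / (fact j * fact (Suc n) * (- 2) ^ Suc n)"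
    using a_coeff_eq[of j "Suc n"] by (simp only: add_Suc_right)
  ultimately show ?thesis
    unfolding a_coeff_eq times_divide_times_eq power_Suc by (simp only: mult_ac)
qed

text \<open>The ratio of neighbours with the same upper index. With the ratio in the upper index
  from \<open>a_coeff_Suc_eq\<close>, all coefficients in a recurrence become rational multiples of
  a single one.\<close>

lemma a_coeff_pred_eq:
  "a_coeff (Suc (Suc (i + n))) (Suc i)
    = a_coeff (Suc (Suc i + n)) (Suc (Suc i)) * ((real i + 1) * (real i + 2 * n + 2) / (- 2 * (real n + 1)))"
proof -
  have f: "fact (i + 2 * Suc n) = fact (Suc i + 2 * n) * (real i + 2 * n + 2)"
    by (simp add: algebra_simps)
  have g: "fact (Suc n) = (real n + 1) * fact n" "fact (Suc i) = (real i + 1) * fact i" by simp_all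
  have i: "real i + 1 \<noteq> 0" by linarith
  have "a_coeff (Suc (Suc (i + n))) (Suc i)
      = fact (i + 2 * Suc n) / (fact i * fact (Suc n) * (- 2) ^ Suc n)"
    using a_coeff_eq[of i "Suc n"] by (simp only: add_Suc_right)
  also have "\<dots> = ((real i + 1) * fact (i + 2 * Suc n)) / ((real i + 1) * (fact i * fact (Suc n) * (- 2) ^ Suc n))"
    by (rule mult_divide_mult_cancel_left[OF i, symmetric])
  also have "\<dots> = a_coeff (Suc (Suc i + n)) (Suc (Suc i))
      * ((real i + 1) * (real i + 2 * n + 2) / (- 2 * (real n + 1)))"
    unfolding a_coeff_eq[of "Suc i" n] times_divide_times_eq power_Suc f g by (simp only: mult_ac)
  finally show ?thesis .
qed

text \<open>Coefficient comparison for one Laplacian: the term of index \<open>Suc i\<close>, with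
  exponent \<open>q\<close> of \<beta>, keeps a multiple of itself and receives one from index
  \<open>i\<close>, whose exponent is \<open>q - 1\<close>. The factor on the left is the new factor
  of the product.\<close>

lemma a_coeff_recurrence:
  fixes m :: real
  assumes "i < k"
  defines "q \<equiv> real (Suc i) - 2 * real k - 1"
  shows "(m - 2 * real k - 3) * a_coeff (Suc (Suc k)) (Suc (Suc i)) =
    a_coeff (Suc k) (Suc (Suc i)) * q * (q + m - 2) + a_coeff (Suc k) (Suc i) * (2 * (q - 1) + m - 1)"
proof -
  obtain n where k: "k = Suc i + n" using assms(1) less_iff_Suc_add by auto
  define X where "X = a_coeff (Suc (Suc i + n)) (Suc (Suc i))"
  \<comment> \<open>\<open>Y\<close> is a common factor of two of the three coefficients, and
    \<open>X * q\<close> is a multiple of it as well, so a polynomial identity remains.\<close>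
  define Y where "Y = X * (real i + 2 * n + 2) / (- 2 * (real n + 1))"
  have 1: "a_coeff (Suc (Suc k)) (Suc (Suc i)) = Y * (real i + 2 * n + 3)"
    using a_coeff_Suc_eq[of "Suc i" n] by (simp add: k X_def Y_def algebra_simps)
  have 2: "a_coeff (Suc k) (Suc i) = Y * (real i + 1)"
    using a_coeff_pred_eq[of i n] by (simp add: k X_def Y_def mult_ac)
  have 3: "a_coeff (Suc k) (Suc (Suc i)) = X" by (simp add: k X_def)
  have q: "q = - (real i + 2 * n + 2)" by (simp add: q_def k)
  have "real n + 1 \<noteq> 0" by linarith
  then have XY: "X * q = 2 * (real n + 1) * Y" by (simp add: Y_def q field_simps)
  have "X * q * (q + m - 2) + Y * (real i + 1) * (2 * (q - 1) + m - 1)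
      = (m - 2 * real k - 3) * (Y * (real i + 2 * n + 3))"
    unfolding XY by (simp add: q k algebra_simps)
  then show ?thesis unfolding 1 2 3 by simp
qed

text \<open>The boundary case of the recurrence: the lowest term has no predecessor to receive a
  contribution from.\<close>

lemma a_coeff_recurrence_0:
  fixes m :: real
  shows "(m - 2 * real k - 3) * a_coeff (Suc (Suc k)) (Suc 0) =
    a_coeff (Suc k) (Suc 0) * (- 2 * real k - 1) * ((- 2 * real k - 1) + m - 2)"
proof -
  have "real k + 1 \<noteq> 0" by linarith
  then have "(2 * real k + 1) * (2 * real k + 2) / (- 2 * (real k + 1)) = - 2 * real k - 1"
    by (simp add: field_simps)
  then have "a_coeff (Suc (Suc k)) (Suc 0) = a_coeff (Suc k) (Suc 0) * (- 2 * real k - 1)"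
    using a_coeff_Suc_eq[of 0 k] by simp
  then show ?thesis by (simp only:) (simp add: algebra_simps)
qed

text \<open>Coefficient comparison for \<open>V_j = \<beta> u_j + j u_(j-1)\<close>: the function
  \<open>u_i\<close> is reached from \<open>V_i\<close> and, with weight \<open>i + 1\<close>, from
  \<open>V_(i+1)\<close>. For \<open>i = 0\<close> the two cancel, so the first formula starts at
  \<open>j = 1\<close>.\<close>

lemma a_coeff_quotient:
  assumes "i < k"
  shows "a_coeff (Suc k) (Suc i) + (real i + 1) * a_coeff (Suc k) (Suc (Suc i))
    = (if i = 0 then 0 else a_coeff k i)"
proof -
  obtain n where k: "k = Suc i + n" using assms(1) less_iff_Suc_add by auto
  have n: "real n + 1 \<noteq> 0" by linarith
  define X where "X = a_coeff (Suc (Suc i + n)) (Suc (Suc i))"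
  define Y where "Y = X * (real i + 1) / (- 2 * (real n + 1))"
  have 2: "a_coeff (Suc k) (Suc i) = Y * (real i + 2 * n + 2)"
    using a_coeff_pred_eq[of i n] by (simp add: k X_def Y_def mult_ac)
  have 3: "(real i + 1) * a_coeff (Suc k) (Suc (Suc i)) = - 2 * (real n + 1) * Y"
    using n by (simp add: k X_def Y_def field_simps)
  have 4: "a_coeff (Suc k) (Suc i) + (real i + 1) * a_coeff (Suc k) (Suc (Suc i)) = Y * real i"
    unfolding 2 3 by (simp add: algebra_simps)
  show ?thesis
  proof (cases i)
    case 0
    then show ?thesis using 4 by simp
  next
    case (Suc l)
    have "a_coeff k i = a_coeff (Suc (Suc (l + n))) (Suc l)" by (simp add: k Suc)
    also have "\<dots> = fact (l + 2 * Suc n) / (fact l * fact (Suc n) * (- 2) ^ Suc n)"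
      using a_coeff_eq[of l "Suc n"] by (simp only: add_Suc_right)
    \<comment> \<open>Expanding by \<open>i (i + 1)\<close> turns \<open>fact l\<close> in the
      denominator into \<open>fact (Suc i)\<close>, as \<open>i = Suc l\<close>.\<close>
    also have "\<dots> = (real i * (real i + 1) * fact (l + 2 * Suc n))
        / (real i * (real i + 1) * (fact l * fact (Suc n) * (- 2) ^ Suc n))"
      by (rule mult_divide_mult_cancel_left[symmetric]) (simp add: Suc)
    also have "\<dots> = X * (real i * (real i + 1) / (- 2 * (real n + 1)))"
    proof -
      have f: "l + 2 * Suc n = Suc i + 2 * n" by (simp add: Suc)
      have g: "fact (Suc n) = (real n + 1) * fact n" "fact (Suc i) = (real i + 1) * (real i * fact l)"
        by (simp_all add: Suc)
      show ?thesis
        unfolding X_def a_coeff_eq[of "Suc i" n] times_divide_times_eq power_Suc f g by (simp only: mult_ac)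
    qed
    also have "\<dots> = Y * real i" by (simp add: Y_def)
    finally show ?thesis using 4 Suc by simp
  qed
qed

section \<open>Iterating the Laplacian by comparison of coefficients\<close>

lemma sum_shift_coefficients:
  fixes R :: "nat \<Rightarrow> 'b::real_vector"
  shows "(\<Sum>j\<le>k. \<alpha> j *\<^sub>R R j + \<beta> j *\<^sub>R R (Suc j))
    = \<alpha> 0 *\<^sub>R R 0 + (\<Sum>i<k. (\<alpha> (Suc i) + \<beta> i) *\<^sub>R R (Suc i)) + \<beta> k *\<^sub>R R (Suc k)"
proof -
  have "(\<Sum>j\<le>k. \<alpha> j *\<^sub>R R j) = \<alpha> 0 *\<^sub>R R 0 + (\<Sum>i<k. \<alpha> (Suc i) *\<^sub>R R (Suc i))"
    by (rule sum.atMost_shift)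
  moreover have "(\<Sum>j\<le>k. \<beta> j *\<^sub>R R (Suc j)) = (\<Sum>i<k. \<beta> i *\<^sub>R R (Suc i)) + \<beta> k *\<^sub>R R (Suc k)"
    by (simp add: lessThan_Suc_atMost[symmetric])
  ultimately show ?thesis by (simp add: sum.distrib scaleR_add_left)
qed

lemma iterated_laplacian_radial:
  fixes g :: "(real \<times> 'c::euclidean_space) ^ 'n::finite \<Rightarrow> 'b::real_normed_vector"
  assumes VW: "harmonic_tower S V W"
    and g: "\<And>p. p \<in> axial_domain S \<Longrightarrow> g (upd_at h x p) = radial (V 0) (- 1) p"
    and p: "p \<in> axial_domain S"
  shows "has_laplacian_at h ((laplacian_at h ^^ k) g) (upd_at h x p)" (is "?H k")
    and "(laplacian_at h ^^ k) g (upd_at h x p) =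
      (\<Prod>i=1..k. real DIM('c) - 2 * real i - 1) *\<^sub>R
        (\<Sum>j\<le>k. a_coeff (Suc k) (Suc j) *\<^sub>R radial (V j) (int j - 2 * int k - 1) p)"
proof -
  let ?m = "real DIM('c)"
  define P where "P k = (\<Prod>i=1..k. ?m - 2 * real i - 1)" for k
  define c where "c k j = P k * a_coeff (Suc k) (Suc j)" for k j
  \<comment> \<open>The induction runs over all points of \<open>axial_domain S\<close> at once,
    since the next Laplacian needs the formula in a neighbourhood. The index starts at 0, one below
    that of the second formula.\<close>
  have *: "(laplacian_at h ^^ k) g (upd_at h x p) =
      (\<Sum>j\<le>k. c k j *\<^sub>R radial (V j) (int j - 2 * int k - 1) p)" if "p \<in> axial_domain S" for p
    using that
  proof (induction k arbitrary: p)
    case 0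
    then show ?case using g by (simp add: c_def P_def a_coeff_top)
  next
    case (Suc k)
    define R where "R j = radial (V j) (int j - 2 * int (Suc k) - 1) p" for j
    define q where "q j = real j - 2 * real k - 1" for j
    define \<alpha> where "\<alpha> j = c k j * q j * (q j + ?m - 2)" for j
    define \<beta> where "\<beta> j = c k j * (2 * q j + ?m - 1)" for j
    have r: "radial (V j) (int j - 2 * int k - 1 - 2) p = R j"
      "radial (V (Suc j)) (int j - 2 * int k - 1 - 1) p = R (Suc j)"
      "real_of_int (int j - 2 * int k - 1) = q j" for j
      by (simp_all add: R_def q_def algebra_simps)
    have P: "P (Suc k) = P k * (?m - 2 * real k - 3)"
      by (simp add: P_def algebra_simps)
    have "(laplacian_at h ^^ Suc k) g (upd_at h x p) = (\<Sum>j\<le>k. \<alpha> j *\<^sub>R R j + \<beta> j *\<^sub>R R (Suc j))"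
      using laplacian_radial(2)[OF VW Suc.prems Suc.IH, unfolded r] by (simp add: \<alpha>_def \<beta>_def)
    also have "\<dots> = \<alpha> 0 *\<^sub>R R 0 + (\<Sum>i<k. (\<alpha> (Suc i) + \<beta> i) *\<^sub>R R (Suc i)) + \<beta> k *\<^sub>R R (Suc k)"
      by (rule sum_shift_coefficients)
    also have "\<alpha> 0 = c (Suc k) 0"
      using a_coeff_recurrence_0[of ?m k] by (auto simp: \<alpha>_def c_def q_def P)
    \<comment> \<open>Here \<open>q k = - k - 1\<close>, so \<open>2 q + m - 1\<close> is exactly
      the new factor \<open>m - 2 k - 3\<close>, and both coefficients equal 1.\<close>
    also have "\<beta> k = c (Suc k) (Suc k)"
      by (simp add: \<beta>_def c_def q_def P a_coeff_top)
    also have "(\<Sum>i<k. (\<alpha> (Suc i) + \<beta> i) *\<^sub>R R (Suc i)) = (\<Sum>i<k. c (Suc k) (Suc i) *\<^sub>R R (Suc i))"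
    proof (intro sum.cong refl)
      fix i assume "i \<in> {..<k}"
      then have "i < k" by simp
      from a_coeff_recurrence[OF this, of ?m]
      have "c (Suc k) (Suc i) = P k * (a_coeff (Suc k) (Suc (Suc i)) * q (Suc i) * (q (Suc i) + ?m - 2)
          + a_coeff (Suc k) (Suc i) * (2 * (q (Suc i) - 1) + ?m - 1))"
        by (simp add: c_def P q_def mult.assoc)
      also have "\<dots> = \<alpha> (Suc i) + \<beta> i"
        by (simp add: \<alpha>_def \<beta>_def c_def q_def algebra_simps)
      finally show "(\<alpha> (Suc i) + \<beta> i) *\<^sub>R R (Suc i) = c (Suc k) (Suc i) *\<^sub>R R (Suc i)" by simp
    qed
    also have "c (Suc k) 0 *\<^sub>R R 0 + (\<Sum>i<k. c (Suc k) (Suc i) *\<^sub>R R (Suc i))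
        + c (Suc k) (Suc k) *\<^sub>R R (Suc k) = (\<Sum>j\<le>Suc k. c (Suc k) j *\<^sub>R R j)"
      by (simp add: sum.atMost_shift)
    finally show ?case by (simp add: R_def)
  qed
  show "?H k" by (rule laplacian_radial(1)[OF VW p *])
  show "(laplacian_at h ^^ k) g (upd_at h x p) =
      (\<Prod>i=1..k. real DIM('c) - 2 * real i - 1) *\<^sub>R
        (\<Sum>j\<le>k. a_coeff (Suc k) (Suc j) *\<^sub>R radial (V j) (int j - 2 * int k - 1) p)"
    using *[OF p] by (simp add: c_def P_def scaleR_sum_right)
qed

section \<open>Derivatives of the quotient by \<open>\<beta>\<close>\<close>

text \<open>By Leibniz, the derivatives \<open>u\<^sub>j\<close> of \<open>V\<^sub>0 / \<beta>\<close> satisfy \<open>\<beta> u\<^sub>j + j u\<^bsub>j-1\<^esub> = V\<^sub>j\<close>.\<close>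

primrec quotient_tower :: "(nat \<Rightarrow> complex \<Rightarrow> 'b::real_vector) \<Rightarrow> nat \<Rightarrow> complex \<Rightarrow> 'b" where
  "quotient_tower V 0 \<zeta> = inverse (Im \<zeta>) *\<^sub>R V 0 \<zeta>"
| "quotient_tower V (Suc j) \<zeta> =
    inverse (Im \<zeta>) *\<^sub>R (V (Suc j) \<zeta> - real (Suc j) *\<^sub>R quotient_tower V j \<zeta>)"

text \<open>Only the \<beta>-part is followed, hence the existential \<open>L\<close>.
  Differentiating \<open>inverse (Im \<zeta>)\<close> contributes one further copy of the current
  quotient, which raises the factor \<open>Suc j\<close> to \<open>Suc (Suc j)\<close>.\<close>

lemma quotient_tower_has_derivative:
  assumes VW: "harmonic_tower S V W" and "\<zeta> \<in> S" "Im \<zeta> \<noteq> 0"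
  shows "\<exists>L. (quotient_tower V j has_derivative
    (\<lambda>d. Re d *\<^sub>R L + Im d *\<^sub>R quotient_tower V (Suc j) \<zeta>)) (at \<zeta>)"
proof -
  have inv: "((\<lambda>\<zeta>. inverse (Im \<zeta>)) has_derivative
      (\<lambda>d. - (inverse (Im \<zeta>) * Im d * inverse (Im \<zeta>)))) (at \<zeta>)"
    using assms(3) by (auto intro!: derivative_eq_intros)
  have V: "(V j has_derivative (\<lambda>d. Re d *\<^sub>R W j \<zeta> + Im d *\<^sub>R V (Suc j) \<zeta>)) (at \<zeta>)" for j
    using assms by (simp add: harmonic_tower_def)
  show ?thesis
  proof (induction j)
    case 0
    have e: "quotient_tower V 0 = (\<lambda>\<zeta>. inverse (Im \<zeta>) *\<^sub>R V 0 \<zeta>)" by (rule ext) simp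
    have "(quotient_tower V 0 has_derivative (\<lambda>d. inverse (Im \<zeta>) *\<^sub>R (Re d *\<^sub>R W 0 \<zeta> + Im d *\<^sub>R V (Suc 0) \<zeta>)
        + (- (inverse (Im \<zeta>) * Im d * inverse (Im \<zeta>))) *\<^sub>R V 0 \<zeta>)) (at \<zeta>)"
      unfolding e by (rule has_derivative_scaleR[OF inv V])
    also have "(\<lambda>d. inverse (Im \<zeta>) *\<^sub>R (Re d *\<^sub>R W 0 \<zeta> + Im d *\<^sub>R V (Suc 0) \<zeta>)
        + (- (inverse (Im \<zeta>) * Im d * inverse (Im \<zeta>))) *\<^sub>R V 0 \<zeta>)
      = (\<lambda>d. Re d *\<^sub>R (inverse (Im \<zeta>) *\<^sub>R W 0 \<zeta>) + Im d *\<^sub>R quotient_tower V (Suc 0) \<zeta>)"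
      by (simp add: fun_eq_iff algebra_simps)
    finally show ?case by blast
  next
    case (Suc j)
    then obtain L where L: "(quotient_tower V j has_derivative
      (\<lambda>d. Re d *\<^sub>R L + Im d *\<^sub>R quotient_tower V (Suc j) \<zeta>)) (at \<zeta>)" by blast
    define s where "s = real (Suc j)"
    have e: "quotient_tower V (Suc j) = (\<lambda>\<zeta>. inverse (Im \<zeta>) *\<^sub>R (V (Suc j) \<zeta> - s *\<^sub>R quotient_tower V j \<zeta>))"
      by (rule ext) (simp add: s_def)
    have "((\<lambda>\<zeta>. inverse (Im \<zeta>) *\<^sub>R (V (Suc j) \<zeta> - s *\<^sub>R quotient_tower V j \<zeta>)) has_derivative (\<lambda>d. inverse (Im \<zeta>) *\<^sub>R
        ((Re d *\<^sub>R W (Suc j) \<zeta> + Im d *\<^sub>R V (Suc (Suc j)) \<zeta>)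
          - s *\<^sub>R (Re d *\<^sub>R L + Im d *\<^sub>R quotient_tower V (Suc j) \<zeta>))
        + (- (inverse (Im \<zeta>) * Im d * inverse (Im \<zeta>))) *\<^sub>R (V (Suc j) \<zeta> - s *\<^sub>R quotient_tower V j \<zeta>))) (at \<zeta>)"
      by (rule has_derivative_scaleR[OF inv has_derivative_diff[OF V has_derivative_scaleR_right[OF L]]])
    also have "(\<lambda>d. inverse (Im \<zeta>) *\<^sub>R
        ((Re d *\<^sub>R W (Suc j) \<zeta> + Im d *\<^sub>R V (Suc (Suc j)) \<zeta>)
          - s *\<^sub>R (Re d *\<^sub>R L + Im d *\<^sub>R quotient_tower V (Suc j) \<zeta>))
        + (- (inverse (Im \<zeta>) * Im d * inverse (Im \<zeta>))) *\<^sub>R (V (Suc j) \<zeta> - s *\<^sub>R quotient_tower V j \<zeta>))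
      = (\<lambda>d. Re d *\<^sub>R (inverse (Im \<zeta>) *\<^sub>R (W (Suc j) \<zeta> - s *\<^sub>R L))
          + Im d *\<^sub>R quotient_tower V (Suc (Suc j)) \<zeta>)"
    proof
      fix d
      let ?u = "quotient_tower V (Suc j) \<zeta>"
      have u: "inverse (Im \<zeta>) *\<^sub>R (V (Suc j) \<zeta> - s *\<^sub>R quotient_tower V j \<zeta>) = ?u"
        by (simp add: s_def)
      have m1: "(- (inverse (Im \<zeta>) * Im d * inverse (Im \<zeta>))) *\<^sub>R (V (Suc j) \<zeta> - s *\<^sub>R quotient_tower V j \<zeta>)
        = - (inverse (Im \<zeta>) * Im d) *\<^sub>R ?u"
        unfolding u[symmetric] by (simp only: scaleR_scaleR mult_minus_left)
      have m2: "quotient_tower V (Suc (Suc j)) \<zeta> = inverse (Im \<zeta>) *\<^sub>R (V (Suc (Suc j)) \<zeta> - (s + 1) *\<^sub>R ?u)"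
        by (simp only: quotient_tower.simps(2)[of V "Suc j"] s_def of_nat_Suc[of "Suc j"] add.commute)
      show "inverse (Im \<zeta>) *\<^sub>R
        ((Re d *\<^sub>R W (Suc j) \<zeta> + Im d *\<^sub>R V (Suc (Suc j)) \<zeta>) - s *\<^sub>R (Re d *\<^sub>R L + Im d *\<^sub>R ?u))
        + (- (inverse (Im \<zeta>) * Im d * inverse (Im \<zeta>))) *\<^sub>R (V (Suc j) \<zeta> - s *\<^sub>R quotient_tower V j \<zeta>)
       = Re d *\<^sub>R (inverse (Im \<zeta>) *\<^sub>R (W (Suc j) \<zeta> - s *\<^sub>R L))
          + Im d *\<^sub>R quotient_tower V (Suc (Suc j)) \<zeta>"
        unfolding m1 m2 by (simp add: algebra_simps del: quotient_tower.simps)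
    qed
    finally show ?case unfolding e[symmetric] by blast
  qed
qed

text \<open>This identity makes the two formulas of the theorem equivalent: insert the Leibniz
  relation for \<open>V j\<close> and collect each quotient by
  \<open>a_coeff_quotient\<close>.\<close>

lemma quotient_tower_sum:
  fixes V :: "nat \<Rightarrow> complex \<Rightarrow> 'b::real_vector"
  assumes "1 \<le> k" and b: "Im \<zeta> \<noteq> 0"
  shows "(\<Sum>j=1..k. (a_coeff k j * Im \<zeta> powi (int j - 2 * int k)) *\<^sub>R quotient_tower V j \<zeta>)
    = (\<Sum>j\<le>k. (a_coeff (Suc k) (Suc j) * Im \<zeta> powi (int j - 2 * int k - 1)) *\<^sub>R V j \<zeta>)"
proof -
  \<comment> \<open>With the power of \<beta> absorbed, the Leibniz relation multiplied by \<beta>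
    to the power \<open>j - 2k - 1\<close> has coefficients free of \<beta>.\<close>
  define u where "u j = Im \<zeta> powi (int j - 2 * int k) *\<^sub>R quotient_tower V j \<zeta>" for j
  obtain l where k: "k = Suc l" using assms(1) by (cases k) auto
  have pw: "Im \<zeta> powi (n - 1) * Im \<zeta> = Im \<zeta> powi n" for n
    using b by (simp add: power_int_diff)
  have 0: "Im \<zeta> powi (int 0 - 2 * int k - 1) *\<^sub>R V 0 \<zeta> = u 0"
    using b by (simp add: u_def power_int_diff divide_inverse)
  have S: "Im \<zeta> powi (int (Suc j) - 2 * int k - 1) *\<^sub>R V (Suc j) \<zeta> = u (Suc j) + real (Suc j) *\<^sub>R u j" for j
  proof -
    have "V (Suc j) \<zeta> = Im \<zeta> *\<^sub>R quotient_tower V (Suc j) \<zeta> + real (Suc j) *\<^sub>R quotient_tower V j \<zeta>"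
      using b by simp
    then show ?thesis
      by (simp only: scaleR_add_right scaleR_scaleR pw u_def) (simp add: mult.commute)
  qed
  define A where "A j = a_coeff (Suc k) (Suc j)" for j
  have "(\<Sum>j\<le>k. (A j * Im \<zeta> powi (int j - 2 * int k - 1)) *\<^sub>R V j \<zeta>)
    = A 0 *\<^sub>R u 0 + (\<Sum>j<k. A (Suc j) *\<^sub>R (u (Suc j) + real (Suc j) *\<^sub>R u j))"
    unfolding sum.atMost_shift scaleR_scaleR[symmetric] 0 S ..
  also have "\<dots> = A 0 *\<^sub>R u 0 + (\<Sum>j\<le>l. (real (Suc j) * A (Suc j)) *\<^sub>R u j + A (Suc j) *\<^sub>R u (Suc j))"
    by (simp add: k lessThan_Suc_atMost scaleR_add_right add.commute mult.commute)
  also have "\<dots> = (A 0 + real (Suc 0) * A (Suc 0)) *\<^sub>R u 0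
      + (\<Sum>j<l. (A (Suc j) + real (Suc (Suc j)) * A (Suc (Suc j))) *\<^sub>R u (Suc j)) + A (Suc l) *\<^sub>R u (Suc l)"
    unfolding sum_shift_coefficients[of "\<lambda>j. real (Suc j) * A (Suc j)" u "\<lambda>j. A (Suc j)" l]
    by (simp add: scaleR_add_left add_ac)
  also have "A 0 + real (Suc 0) * A (Suc 0) = 0"
    using a_coeff_quotient[of 0 k] by (simp add: A_def k)
  also have "(\<Sum>j<l. (A (Suc j) + real (Suc (Suc j)) * A (Suc (Suc j))) *\<^sub>R u (Suc j))
    = (\<Sum>j<l. a_coeff k (Suc j) *\<^sub>R u (Suc j))"
  proof (intro sum.cong refl)
    fix j assume "j \<in> {..<l}"
    then show "(A (Suc j) + real (Suc (Suc j)) * A (Suc (Suc j))) *\<^sub>R u (Suc j) = a_coeff k (Suc j) *\<^sub>R u (Suc j)"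
      using a_coeff_quotient[of "Suc j" k] by (simp add: A_def k add.commute)
  qed
  also have "A (Suc l) = a_coeff k (Suc l)" by (simp add: A_def k a_coeff_top)
  also have "0 *\<^sub>R u 0 + (\<Sum>j<l. a_coeff k (Suc j) *\<^sub>R u (Suc j)) + a_coeff k (Suc l) *\<^sub>R u (Suc l)
    = (\<Sum>j<k. a_coeff k (Suc j) *\<^sub>R u (Suc j))"
    by (simp add: k)
  also have "\<dots> = (\<Sum>j=1..k. a_coeff k j *\<^sub>R u j)"
    by (rule sum.reindex_bij_witness[of _ "\<lambda>j. j - 1" Suc]) auto
  finally show ?thesis by (simp add: u_def A_def)
qed

section \<open>Towers from holomorphic functions\<close>

lemma has_derivative_vec_lambda:
  fixes f :: "'a::finite \<Rightarrow> 'c::real_normed_vector \<Rightarrow> real"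
  assumes "\<And>A. (f A has_derivative f' A) F"
  shows "((\<lambda>x. \<chi> A. f A x) has_derivative (\<lambda>d. \<chi> A. f' A d)) F"
proof -
  have *: "(\<chi> A. u A) = (\<Sum>A\<in>UNIV. u A *\<^sub>R (axis A 1 :: real ^ 'a))" for u
    by (simp add: vec_eq_iff axis_def if_distrib cong: if_cong)
  show ?thesis unfolding *
    by (intro has_derivative_sum has_derivative_scaleR_left assms)
qed

text \<open>On a holomorphic function the \<alpha>-derivative is \<open>deriv\<close> and the
  \<beta>-derivative is \<open>\<i>\<close> times \<open>deriv\<close>; \<open>\<i>^2 = -1\<close>
  gives the minus sign in the tower. The index \<open>A\<close> runs over real coordinates.\<close>

lemma harmonic_tower_holomorphic:
  fixes \<phi> :: "'a::finite \<Rightarrow> complex \<Rightarrow> complex"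
  assumes S: "open S" and hol: "\<And>A. \<phi> A holomorphic_on S"
  shows "harmonic_tower S (\<lambda>j \<zeta>. \<chi> A. Im (\<i> ^ j * (deriv ^^ j) (\<phi> A) \<zeta>))
    (\<lambda>j \<zeta>. \<chi> A. Im (\<i> ^ j * (deriv ^^ Suc j) (\<phi> A) \<zeta>))"
proof -
  have D: "((\<lambda>\<zeta>. \<chi> A. Im (c * (deriv ^^ n) (\<phi> A) \<zeta>)) has_derivative
      (\<lambda>d. \<chi> A. Im (c * ((deriv ^^ Suc n) (\<phi> A) \<zeta> * d)))) (at \<zeta>)" if "\<zeta> \<in> S" for c n \<zeta>
  proof (intro has_derivative_vec_lambda has_derivative_Im has_derivative_mult_right)
    fix A
    have "((deriv ^^ n) (\<phi> A) has_field_derivative (deriv ^^ Suc n) (\<phi> A) \<zeta>) (at \<zeta>)"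
      using holomorphic_derivI[OF holomorphic_higher_deriv[OF hol S] S that] by simp
    then show "((deriv ^^ n) (\<phi> A) has_derivative (\<lambda>d. (deriv ^^ Suc n) (\<phi> A) \<zeta> * d)) (at \<zeta>)"
      by (simp only: has_field_derivative_def)
  qed
  have split: "(\<lambda>d. \<chi> A. Im (c * (X A * d))) =
      (\<lambda>d. Re d *\<^sub>R (\<chi> A. Im (c * X A)) + Im d *\<^sub>R (\<chi> A. Im (\<i> * c * X A)))" for c and X :: "'a \<Rightarrow> complex"
    by (simp add: fun_eq_iff vec_eq_iff algebra_simps)
  have neg: "(\<chi> A. Im (\<i> ^ j * X A)) = - (\<chi> A. Im (\<i> ^ Suc (Suc j) * X A))"
    for j and X :: "'a \<Rightarrow> complex"
    by (simp add: vec_eq_iff mult.assoc[symmetric])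
  show ?thesis
    unfolding harmonic_tower_def
  proof (intro conjI ballI allI S)
    fix \<zeta> j assume "\<zeta> \<in> S"
    note D = D[OF this, unfolded split]
    show "((\<lambda>\<zeta>. \<chi> A. Im (\<i> ^ j * (deriv ^^ j) (\<phi> A) \<zeta>)) has_derivative
        (\<lambda>d. Re d *\<^sub>R (\<chi> A. Im (\<i> ^ j * (deriv ^^ Suc j) (\<phi> A) \<zeta>))
          + Im d *\<^sub>R (\<chi> A. Im (\<i> ^ Suc j * (deriv ^^ Suc j) (\<phi> A) \<zeta>)))) (at \<zeta>)"
      using D[of "\<i> ^ j" j] by (simp only: power_Suc)
    show "((\<lambda>\<zeta>. \<chi> A. Im (\<i> ^ j * (deriv ^^ Suc j) (\<phi> A) \<zeta>)) has_derivative
        (\<lambda>d. Re d *\<^sub>R (- (\<chi> A. Im (\<i> ^ Suc (Suc j) * (deriv ^^ Suc (Suc j)) (\<phi> A) \<zeta>)))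
          + Im d *\<^sub>R (\<chi> A. Im (\<i> ^ Suc j * (deriv ^^ Suc (Suc j)) (\<phi> A) \<zeta>)))) (at \<zeta>)"
      using D[of "\<i> ^ j" "Suc j"] unfolding neg[symmetric] by (simp only: power_Suc)
  qed
qed

lemma harmonic_tower_sum:
  assumes S: "open S" and VW: "\<And>K. K \<in> I \<Longrightarrow> harmonic_tower S (V K) (W K)"
    and B: "\<And>K. K \<in> I \<Longrightarrow> bounded_linear (B K)"
  shows "harmonic_tower S (\<lambda>j \<zeta>. \<Sum>K\<in>I. B K (V K j \<zeta>)) (\<lambda>j \<zeta>. \<Sum>K\<in>I. B K (W K j \<zeta>))"
  unfolding harmonic_tower_def
proof (intro conjI ballI allI S)
  have sum: "((\<lambda>\<zeta>. \<Sum>K\<in>I. B K (X K \<zeta>)) has_derivative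
      (\<lambda>d. Re d *\<^sub>R (\<Sum>K\<in>I. B K (Y K)) + Im d *\<^sub>R (\<Sum>K\<in>I. B K (Z K)))) (at \<zeta>)"
    if X: "\<And>K. K \<in> I \<Longrightarrow> (X K has_derivative (\<lambda>d. Re d *\<^sub>R Y K + Im d *\<^sub>R Z K)) (at \<zeta>)" for X Y Z \<zeta>
  proof -
    have "((\<lambda>\<zeta>. \<Sum>K\<in>I. B K (X K \<zeta>)) has_derivative
        (\<lambda>d. \<Sum>K\<in>I. B K (Re d *\<^sub>R Y K + Im d *\<^sub>R Z K))) (at \<zeta>)"
      by (intro has_derivative_sum bounded_linear.has_derivative[OF B] X)
    also have "(\<lambda>d. \<Sum>K\<in>I. B K (Re d *\<^sub>R Y K + Im d *\<^sub>R Z K))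
      = (\<lambda>d. Re d *\<^sub>R (\<Sum>K\<in>I. B K (Y K)) + Im d *\<^sub>R (\<Sum>K\<in>I. B K (Z K)))"
      unfolding scaleR_sum_right sum.distrib[symmetric]
      by (intro ext sum.cong refl)
        (simp add: linear_add linear_cmul bounded_linear.linear[OF B])
    finally show ?thesis .
  qed
  fix \<zeta> j assume \<zeta>: "\<zeta> \<in> S"
  show "((\<lambda>\<zeta>. \<Sum>K\<in>I. B K (V K j \<zeta>)) has_derivative
      (\<lambda>d. Re d *\<^sub>R (\<Sum>K\<in>I. B K (W K j \<zeta>)) + Im d *\<^sub>R (\<Sum>K\<in>I. B K (V K (Suc j) \<zeta>)))) (at \<zeta>)"
    using VW \<zeta> by (intro sum) (simp add: harmonic_tower_def)
  have "((\<lambda>\<zeta>. \<Sum>K\<in>I. B K (W K j \<zeta>)) has_derivative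
      (\<lambda>d. Re d *\<^sub>R (\<Sum>K\<in>I. B K (- V K (Suc (Suc j)) \<zeta>)) + Im d *\<^sub>R (\<Sum>K\<in>I. B K (W K (Suc j) \<zeta>)))) (at \<zeta>)"
    using VW \<zeta> by (intro sum) (simp add: harmonic_tower_def)
  also have "(\<Sum>K\<in>I. B K (- V K (Suc (Suc j)) \<zeta>)) = - (\<Sum>K\<in>I. B K (V K (Suc (Suc j)) \<zeta>))"
    unfolding sum_negf[symmetric]
    by (intro sum.cong refl) (simp add: linear_neg bounded_linear.linear[OF B])
  finally show "((\<lambda>\<zeta>. \<Sum>K\<in>I. B K (W K j \<zeta>)) has_derivative
      (\<lambda>d. Re d *\<^sub>R (- (\<Sum>K\<in>I. B K (V K (Suc (Suc j)) \<zeta>))) + Im d *\<^sub>R (\<Sum>K\<in>I. B K (W K (Suc j) \<zeta>)))) (at \<zeta>)" .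
qed

text \<open>Each further derivative needs the previous one near the point, so the induction covers
  all of the open set \<open>S\<close>.\<close>

lemma iterated_partial_beta:
  fixes U :: "nat \<Rightarrow> complex \<Rightarrow> 'b::real_normed_vector" and z :: "complex ^ 'n::finite"
  assumes S: "open S" "\<zeta> \<in> S"
    and g: "\<And>\<zeta>. \<zeta> \<in> S \<Longrightarrow> g (upd_at h z \<zeta>) = U 0 \<zeta>"
    and U: "\<And>j \<zeta>. \<zeta> \<in> S \<Longrightarrow> \<exists>L. (U j has_derivative (\<lambda>d. Re d *\<^sub>R L + Im d *\<^sub>R U (Suc j) \<zeta>)) (at \<zeta>)"
  shows "(partial_beta h ^^ j) g (upd_at h z \<zeta>) = U j \<zeta>"
    and "dir_differentiable ((partial_beta h ^^ j) g) (axis h \<i>) (upd_at h z \<zeta>)"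
proof -
  have *: "(partial_beta h ^^ j) g (upd_at h z \<zeta>) = U j \<zeta>" if "\<zeta> \<in> S" for j \<zeta>
    using that
  proof (induction j arbitrary: \<zeta>)
    case 0
    then show ?case using g by simp
  next
    case (Suc j)
    obtain L where "(U j has_derivative (\<lambda>d. Re d *\<^sub>R L + Im d *\<^sub>R U (Suc j) \<zeta>)) (at \<zeta>)"
      using U[OF Suc.prems] by blast
    from dir_deriv_upd_at(2)[OF S(1) Suc.prems Suc.IH this, where v = \<i>] show ?case by simp
  qed
  show "(partial_beta h ^^ j) g (upd_at h z \<zeta>) = U j \<zeta>" by (rule *[OF S(2)])
  obtain L where "(U j has_derivative (\<lambda>d. Re d *\<^sub>R L + Im d *\<^sub>R U (Suc j) \<zeta>)) (at \<zeta>)"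
    using U[OF S(2)] by blast
  from dir_deriv_upd_at(1)[OF S * this]
  show "dir_differentiable ((partial_beta h ^^ j) g) (axis h \<i>) (upd_at h z \<zeta>)" .
qed

section \<open>Cauchy--Riemann equations for the components of a stem function\<close>

lemma linear_bracket: "linear (bracket J K)"
proof -
  have "linear (\<lambda>a. foldr (\<lambda>k b. paravec (J $ k) \<star> b) xs a)" for xs
    by (induction xs) (auto intro!: linearI simp: clifford_mult_linear_simps linear_add linear_cmul)
  then show ?thesis by (simp add: bracket_def[abs_def])
qed

text \<open>Left multiplication by an imaginary unit is injective, because applying it twice gives
  the negative of the identity.\<close>

lemma bracket_eq_0:
  assumes J: "\<And>l. J $ l \<in> imag_units" and "bracket J K a = 0"
  shows "a = 0"
proof -
  have inj: "b = 0" if "paravec (J $ k) \<star> b = 0" for k b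
  proof -
    have "- b = paravec (J $ k) \<star> (paravec (J $ k) \<star> b)"
      using paravec_imag_unit_square[OF J[of k]]
      by (simp add: clifford_mult_linear_simps flip: clifford_mult_assoc)
    then show ?thesis using that by (simp add: clifford_mult_linear_simps)
  qed
  have "foldr (\<lambda>k b. paravec (J $ k) \<star> b) xs a = 0 \<Longrightarrow> a = 0" for xs
    by (induction xs) (auto dest: inj)
  then show ?thesis using assms(2) unfolding bracket_def .
qed

text \<open>
  Replacing \<open>J\<^sub>l\<close> by \<open>-J\<^sub>l\<close> changes the sign of exactly the summands with \<open>l \<in> K\<close>, so these
  flips isolate each summand.
\<close>

lemma bracket_sum_eq_0:
  fixes a :: "('m::{finite,linorder}, 'n::{finite,linorder}) stem_value"
  assumes zero: "\<And>J. (\<And>l. J $ l \<in> imag_units) \<Longrightarrow> (\<Sum>K\<in>UNIV. bracket J K (a $ K)) = 0"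
  shows "a = 0"
proof -
  \<comment> \<open>\<open>L\<close> collects the variables already flipped. Flipping one more
    splits the sum into two parts that are equal and add up to 0; at \<open>L = UNIV\<close> only
    \<open>K0\<close> is left.\<close>
  have step: "(\<Sum>K | K \<inter> L = K0 \<inter> L. bracket J K (a $ K)) = 0"
    if "finite L" "\<And>l. J $ l \<in> imag_units" for L K0 J
    using that
  proof (induction L arbitrary: J rule: finite_induct)
    case empty
    then show ?case using zero by simp
  next
    case (insert h L)
    define A where "A = {K. K \<inter> L = K0 \<inter> L \<and> h \<in> K}"
    define B where "B = {K. K \<inter> L = K0 \<inter> L \<and> h \<notin> K}"
    define J' where "J' = upd_at h J (- (J $ h))"
    have J': "J' $ l \<in> imag_units" for l
      using insert.prems[of l] by (auto simp: J'_def imag_units_def)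
    have AB: "{K. K \<inter> L = K0 \<inter> L} = A \<union> B" "A \<inter> B = {}" by (auto simp: A_def B_def)
    have "(\<Sum>K\<in>A. bracket J K (a $ K)) + (\<Sum>K\<in>B. bracket J K (a $ K)) = 0"
      using insert.IH[OF insert.prems] AB by (simp add: sum.union_disjoint)
    moreover have "(\<Sum>K\<in>A. bracket J' K (a $ K)) + (\<Sum>K\<in>B. bracket J' K (a $ K)) = 0"
      using insert.IH[OF J'] AB by (simp add: sum.union_disjoint)
    moreover have "(\<Sum>K\<in>A. bracket J' K (a $ K)) = - (\<Sum>K\<in>A. bracket J K (a $ K))"
      unfolding sum_negf[symmetric] by (intro sum.cong refl bracket_flip[of h]) (auto simp: A_def J'_def)
    moreover have "(\<Sum>K\<in>B. bracket J' K (a $ K)) = (\<Sum>K\<in>B. bracket J K (a $ K))"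
      by (intro sum.cong refl bracket_cong) (auto simp: B_def J'_def)
    ultimately have e: "(\<Sum>K\<in>A. bracket J K (a $ K)) = (\<Sum>K\<in>B. bracket J K (a $ K))"
      "(\<Sum>K\<in>A. bracket J K (a $ K)) + (\<Sum>K\<in>B. bracket J K (a $ K)) = 0" by simp_all
    then have "2 *\<^sub>R (\<Sum>K\<in>B. bracket J K (a $ K)) = 0" by (simp add: scaleR_2)
    with e have "(\<Sum>K\<in>A. bracket J K (a $ K)) = 0" "(\<Sum>K\<in>B. bracket J K (a $ K)) = 0" by simp_all
    moreover have "{K. K \<inter> insert h L = K0 \<inter> insert h L} = (if h \<in> K0 then A else B)"
      using insert.hyps by (auto simp: A_def B_def)
    ultimately show ?case by simp
  qed
  \<comment> \<open>The type \<open>'m\<close> is inhabited, so a generator supplies an imaginary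
    unit for every variable.\<close>
  obtain i :: 'm where True by simp
  define J :: "'m paravector ^ 'n::{finite,linorder}" where "J = (\<chi> l. (0, axis i 1))"
  have J: "J $ l \<in> imag_units" for l
  proof -
    have "(axis i (1::real) $ j)\<^sup>2 = (if j = i then 1 else 0)" for j
      by (simp add: axis_def)
    then show ?thesis by (simp add: J_def imag_units_def)
  qed
  have "a $ K = 0" for K
    using step[of UNIV J K] J bracket_eq_0[of J K "a $ K"] by simp
  then show ?thesis by (simp add: vec_eq_iff)
qed

text \<open>Carries the hypothesis on the slice derivative over from the circularization to the stem
  function.\<close>

lemma slice_fun_eq_0:
  fixes G :: "complex ^ 'n::{finite,linorder} \<Rightarrow> ('m::{finite,linorder}, 'n) stem_value"
  assumes "symmetric_set D" "stem_function D G" "\<forall>x\<in>circularization D. slice_fun D G x = 0" "z \<in> D"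
  shows "G z = 0"
proof (rule bracket_sum_eq_0)
  fix J :: "'m paravector ^ 'n::{finite,linorder}" assume J: "\<And>l. J $ l \<in> imag_units"
  then have "slice_point z J \<in> circularization D"
    using assms(4) by (auto simp: circularization_def)
  with assms(3) slice_fun_eq[OF assms(1,2,4) J]
  show "(\<Sum>K\<in>UNIV. bracket J K (G z $ K)) = 0" by simp
qed

section \<open>Parity of the derived stem functions under conjugation\<close>

lemma linear_conj_at: "linear (conj_at l)"
  by (rule linearI) (auto simp: conj_at_def vec_eq_iff)

text \<open>Needed to evaluate \<open>slice_dbar\<close> through \<open>slice_fun_eq\<close>.
  Differentiating the parity relation of \<open>F\<close> along the axes gives the same parity,
  except that \<partial>/\<partial>\<beta> in the conjugated variable changes sign;
  \<open>stem_J\<close> compensates by moving \<open>h\<close> in or out of the index set.\<close>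

lemma stem_function_dbar:
  fixes F :: "complex ^ 'n::finite \<Rightarrow> ('m::finite, 'n) stem_value"
  assumes D: "open D" "symmetric_set D" and F: "stem_function D F"
    and F': "\<And>z. z \<in> D \<Longrightarrow> (F has_derivative F' z) (at z)"
  shows "stem_function D (stem_dbar h F)"
  unfolding stem_function_def
proof (intro ballI allI)
  fix z l K assume z: "z \<in> D"
  define R where "R a = (\<chi> K. if l \<in> K then - (a $ K) else a $ K)" for a :: "('m, 'n) stem_value"
  have "linear R" by (rule linearI) (auto simp: R_def vec_eq_iff)
  then have RF: "((\<lambda>w. R (F w)) has_derivative (\<lambda>v. R (F' z v))) (at z)"
    by (intro bounded_linear.has_derivative[OF _ F'[OF z]]) (simp add: linear_conv_bounded_linear)
  have cz: "conj_at l z \<in> D" using D(2) z by (simp add: symmetric_set_def)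
  have "(conj_at l has_derivative conj_at l) (at z)"
    using linear_conj_at by (intro bounded_linear_imp_has_derivative) (simp add: linear_conv_bounded_linear)
  from diff_chain_at[OF this F'[OF cz]]
  have Fc: "((\<lambda>w. F (conj_at l w)) has_derivative (\<lambda>v. F' (conj_at l z) (conj_at l v))) (at z)"
    by (simp add: o_def)
  have "((\<lambda>w. R (F w)) has_derivative (\<lambda>v. F' (conj_at l z) (conj_at l v))) (at z)"
    by (rule has_derivative_transform_within_open[OF Fc D(1) z])
      (use F in \<open>auto simp: stem_function_def R_def vec_eq_iff\<close>)
  from has_derivative_unique[OF this RF]
  have eq: "F' (conj_at l z) (conj_at l v) = R (F' z v)" for v by metis
  note P = dir_deriv_has_derivative(2)[OF F'[OF z]] dir_deriv_has_derivative(2)[OF F'[OF cz]]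
  have "conj_at l (axis h 1) = axis h 1" by (simp add: conj_at_def vec_eq_iff axis_def)
  then have \<alpha>: "F' (conj_at l z) (axis h 1) = R (F' z (axis h 1))" using eq[of "axis h 1"] by simp
  have \<beta>: "F' (conj_at l z) (axis h \<i>) = (if l = h then - R (F' z (axis h \<i>)) else R (F' z (axis h \<i>)))"
  proof (cases "l = h")
    case True
    then have "conj_at l (axis h \<i>) = - axis h \<i>" by (auto simp: conj_at_def vec_eq_iff axis_def)
    then show ?thesis
      using eq[of "axis h \<i>"] True linear_neg[OF has_derivative_linear[OF F'[OF cz]]]
      by (simp add: minus_equation_iff)
  next
    case False
    then have "conj_at l (axis h \<i>) = axis h \<i>" by (auto simp: conj_at_def vec_eq_iff axis_def)
    then show ?thesis using eq[of "axis h \<i>"] False by simp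
  qed
  show "stem_dbar h F (conj_at l z) $ K =
      (if l \<in> K then - (stem_dbar h F z $ K) else stem_dbar h F z $ K)"
    unfolding stem_dbar_def P \<alpha> \<beta> by (auto simp: stem_J_def R_def scaleR_diff_right scaleR_add_right)
qed

text \<open>For \<open>h \<notin> K\<close> both \<open>F z $ insert h K\<close> and
  \<open>Im (z $ h)\<close> are odd under conjugation of the \<open>h\<close>-th variable, so their
  quotient is even.\<close>

lemma stem_function_spherical:
  assumes F: "stem_function D F"
  shows "stem_function {z \<in> D. Im (z $ h) \<noteq> 0} (stem_spherical h F)"
  unfolding stem_function_def
proof (intro ballI allI)
  fix z l K assume "z \<in> {z \<in> D. Im (z $ h) \<noteq> 0}"
  then have "F (conj_at l z) $ insert h K = (if l \<in> insert h K then - (F z $ insert h K) else F z $ insert h K)"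
    using F by (simp add: stem_function_def)
  moreover have "conj_at l z $ h = (if h = l then cnj (z $ h) else z $ h)"
    by (simp add: conj_at_def)
  ultimately show "stem_spherical h F (conj_at l z) $ K =
      (if l \<in> K then - (stem_spherical h F z $ K) else stem_spherical h F z $ K)"
    by (simp add: stem_spherical_def)
qed

text \<open>The components \<open>K\<close> and \<open>insert h K\<close> of the equation are the
  Cauchy-Riemann equations for each real coordinate of the pair. Complex differentiability on an
  open set then supplies derivatives of every order, although \<open>F\<close> is only assumed once
  differentiable.\<close>

lemma stem_dbar_eq_0_tower:
  fixes F :: "complex ^ 'n::finite \<Rightarrow> ('m::finite, 'n) stem_value"
  assumes D: "open D" and F': "\<And>z. z \<in> D \<Longrightarrow> (F has_derivative F' z) (at z)"
    and dbar: "\<And>z. z \<in> D \<Longrightarrow> stem_dbar h F z = 0" and K: "h \<notin> K"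
  obtains V W where "harmonic_tower {\<zeta>. upd_at h z \<zeta> \<in> D} V W"
    "\<And>\<zeta>. V 0 \<zeta> = F (upd_at h z \<zeta>) $ insert h K"
proof -
  define S where "S = {\<zeta>. upd_at h z \<zeta> \<in> D}"
  define \<phi> where "\<phi> A \<zeta> = Complex (F (upd_at h z \<zeta>) $ K $ A) (F (upd_at h z \<zeta>) $ insert h K $ A)" for A \<zeta>
  have S: "open S"
    using open_vimage[OF D continuous_on_upd_at[of UNIV h z]] by (simp add: S_def vimage_def)
  have "\<phi> A holomorphic_on S" for A
  proof (rule holomorphic_onI)
    fix \<zeta> assume \<zeta>: "\<zeta> \<in> S"
    define w where "w = upd_at h z \<zeta>"
    have w: "w \<in> D" using \<zeta> by (simp add: S_def w_def)
    \<comment> \<open>\<open>Complex a b\<close> is the complex derivative, read off in the real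
      direction.\<close>
    define a b where "a = F' w (axis h 1) $ K $ A" and "b = F' w (axis h 1) $ insert h K $ A"
    have lin: "linear (F' w)" using F'[OF w] has_derivative_linear by blast
    have "partial_alpha h F w + stem_J h (partial_beta h F w) = 0"
      using dbar[OF w] by (simp add: stem_dbar_def)
    then have 0: "F' w (axis h 1) + stem_J h (F' w (axis h \<i>)) = 0"
      by (simp add: dir_deriv_has_derivative(2)[OF F'[OF w]])
    from arg_cong[OF this, of "\<lambda>u. u $ K $ A"] K
    have 1: "F' w (axis h \<i>) $ insert h K $ A = a" by (simp add: stem_J_def a_def)
    from arg_cong[OF 0, of "\<lambda>u. u $ insert h K $ A"] K
    have 2: "F' w (axis h \<i>) $ K $ A = - b" by (simp add: stem_J_def b_def add_eq_0_iff)
    have ax: "axis h d = Re d *\<^sub>R axis h 1 + Im d *\<^sub>R axis h \<i>" for d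
      by (simp add: vec_eq_iff axis_def complex_eq_iff)
    have Fax: "F' w (axis h d) = Re d *\<^sub>R F' w (axis h 1) + Im d *\<^sub>R F' w (axis h \<i>)" for d
      by (subst ax) (simp only: linear_add[OF lin] linear_cmul[OF lin])
    have "((\<lambda>\<zeta>. F (upd_at h z \<zeta>)) has_derivative (\<lambda>d. F' w (axis h d))) (at \<zeta>)"
      using diff_chain_at[OF upd_at_has_derivative F'[OF w, unfolded w_def]] by (simp add: o_def w_def)
    then have c: "((\<lambda>\<zeta>. F (upd_at h z \<zeta>) $ L $ A) has_derivative (\<lambda>d. F' w (axis h d) $ L $ A)) (at \<zeta>)" for L
      by (intro bounded_linear.has_derivative[OF bounded_linear_vec_nth])
    have "(\<phi> A has_derivative (\<lambda>d. of_real (F' w (axis h d) $ K $ A)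
        + \<i> * of_real (F' w (axis h d) $ insert h K $ A))) (at \<zeta>)"
      unfolding \<phi>_def[abs_def] Complex_eq
      by (intro has_derivative_add has_derivative_mult_right has_derivative_of_real c)
    also have "(\<lambda>d. of_real (F' w (axis h d) $ K $ A)
        + \<i> * of_real (F' w (axis h d) $ insert h K $ A)) = (\<lambda>d. Complex a b * d)"
    proof
      fix d
      show "of_real (F' w (axis h d) $ K $ A) + \<i> * of_real (F' w (axis h d) $ insert h K $ A)
          = Complex a b * d"
        unfolding Fax[of d] by (simp add: complex_eq_iff 1 2 mult.commute flip: a_def b_def)
    qed
    finally have "(\<phi> A has_field_derivative Complex a b) (at \<zeta>)"
      by (simp add: has_field_derivative_def)
    then show "\<phi> A field_differentiable at \<zeta> within S"
      using field_differentiable_at_within field_differentiable_def by blast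
  qed
  then have "harmonic_tower S (\<lambda>j \<zeta>. \<chi> A. Im (\<i> ^ j * (deriv ^^ j) (\<phi> A) \<zeta>))
    (\<lambda>j \<zeta>. \<chi> A. Im (\<i> ^ j * (deriv ^^ Suc j) (\<phi> A) \<zeta>))"
    by (rule harmonic_tower_holomorphic[OF S])
  then show thesis
    by (rule that[folded S_def]) (simp add: \<phi>_def vec_eq_iff)
qed

section \<open>The spherical derivative\<close>

lemma sgn_imag_unit:
  fixes y :: "real ^ 'm::finite"
  assumes "y \<noteq> 0"
  shows "(0, sgn y) \<in> imag_units"
proof -
  have "norm (sgn y) = 1" using assms by (simp add: norm_sgn)
  then show ?thesis by (simp add: imag_units_def norm_vec_def L2_set_def)
qed

lemma imag_unit_norm:
  assumes "J \<in> imag_units"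
  shows "fst J = 0" "norm (snd J) = 1"
  using assms by (simp_all add: imag_units_def norm_vec_def L2_set_def)

lemma slice_point_upd_at:
  fixes p :: "'m::finite paravector"
  assumes "snd p \<noteq> 0"
  shows "slice_point (upd_at h z (half_plane_coord p)) (upd_at h J (0, sgn (snd p)))
    = upd_at h (slice_point z J) p"
  using assms
  by (auto simp: vec_eq_iff slice_point_def half_plane_coord_def prod_eq_iff sgn_div_norm)

text \<open>The point is represented with unit \<open>sgn (snd p)\<close> in the \<open>h\<close>-th
  variable. Components with \<open>h \<in> K\<close> vanish and the other brackets do not contain
  that unit, so the fixed \<open>J\<close> may be restored and only the half-plane coordinate of
  \<open>p\<close> remains.\<close>

lemma spherical_deriv_radial:
  fixes D :: "(complex ^ 'n::{finite,linorder}) set"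
    and F :: "complex ^ 'n::{finite,linorder} \<Rightarrow> ('m::{finite,linorder}, 'n) stem_value"
    and J :: "'m paravector ^ 'n::{finite,linorder}"
  assumes D: "symmetric_set D" and F: "stem_function D F" and J: "\<And>l. J $ l \<in> imag_units"
    and p: "p \<in> axial_domain {\<zeta>. upd_at h z \<zeta> \<in> D}"
  shows "spherical_deriv D h F (upd_at h (slice_point z J) p) =
    radial (\<lambda>\<zeta>. \<Sum>K | h \<notin> K. bracket J K (F (upd_at h z \<zeta>) $ insert h K)) (- 1) p"
proof -
  define w where "w = upd_at h z (half_plane_coord p)"
  define I where "I = upd_at h J (0, sgn (snd p))"
  have sp: "snd p \<noteq> 0" and w: "w \<in> D"
    using p by (simp_all add: axial_domain_def w_def)
  have I: "I $ l \<in> imag_units" for l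
    using J sgn_imag_unit[OF sp] by (simp add: I_def)
  have im: "Im (w $ h) = norm (snd p)" by (simp add: w_def half_plane_coord_def)
  have D': "symmetric_set {z \<in> D. Im (z $ h) \<noteq> 0}"
    using D by (auto simp: symmetric_set_def conj_at_def)
  have "spherical_deriv D h F (slice_point w I) = (\<Sum>K\<in>UNIV. bracket I K (stem_spherical h F w $ K))"
    unfolding spherical_deriv_def
    by (rule slice_fun_eq[OF D' stem_function_spherical[OF F]]) (use w im sp I in auto)
  also have "\<dots> = (\<Sum>K | h \<notin> K. bracket I K (stem_spherical h F w $ K))"
    by (rule sum.mono_neutral_right) (auto simp: stem_spherical_def bracket_zero)
  also have "\<dots> = (\<Sum>K | h \<notin> K. inverse (norm (snd p)) *\<^sub>R bracket J K (F w $ insert h K))"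
  proof (intro sum.cong refl)
    fix K assume K: "K \<in> {K. h \<notin> K}"
    then have "bracket I K a = bracket J K a" for a
      by (intro bracket_cong) (auto simp: I_def)
    then show "bracket I K (stem_spherical h F w $ K) = inverse (norm (snd p)) *\<^sub>R bracket J K (F w $ insert h K)"
      using K by (simp add: stem_spherical_def im linear_cmul[OF linear_bracket])
  qed
  finally show ?thesis
    using slice_point_upd_at[OF sp, of h z J]
    by (simp add: w_def I_def radial_def scaleR_sum_right power_int_minus)
qed

lemma spherical_deriv_laplacian:
  fixes D :: "(complex ^ 'n::{finite,linorder}) set"
    and F :: "complex ^ 'n::{finite,linorder} \<Rightarrow> ('m::{finite,linorder}, 'n) stem_value"
    and h :: 'n and J :: "'m paravector ^ 'n::{finite,linorder}"
  assumes D: "open D" "symmetric_set D" and F: "stem_function D F" "C1_on D F"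
    and dbar: "\<forall>x\<in>circularization D. slice_dbar D h F x = 0"
    and k: "1 \<le> k" and z: "z \<in> D" "Im (z $ h) > 0" and J: "\<And>l. J $ l \<in> imag_units"
  defines "x \<equiv> slice_point z J"
    and "\<beta> \<equiv> Im (z $ h)"
  shows "has_laplacian_at h ((laplacian_at h ^^ (k - 1)) (spherical_deriv D h F)) x" (is ?has)
    and "\<And>i K. h \<notin> K \<Longrightarrow>
        dir_differentiable ((partial_beta h ^^ i) (\<lambda>w. stem_spherical h F w $ K)) (axis h \<i>) z \<and>
        dir_differentiable ((partial_beta h ^^ i) (\<lambda>w. F w $ insert h K)) (axis h \<i>) z"
    and "(laplacian_at h ^^ k) (spherical_deriv D h F) x =
        (\<Prod>i=1..k. real CARD('m) - 2 * real i - 1) *\<^sub>R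
        (\<Sum>j=1..k. (a_coeff k j * \<beta> powi (int j - 2 * int k)) *\<^sub>R
          (\<Sum>K | h \<notin> K. bracket J K ((partial_beta h ^^ j) (\<lambda>w. stem_spherical h F w $ K) z)))" (is ?first)
    and "(laplacian_at h ^^ k) (spherical_deriv D h F) x =
        (\<Prod>i=1..k. real CARD('m) - 2 * real i - 1) *\<^sub>R
        (\<Sum>j=1..k+1. (a_coeff (k + 1) j * \<beta> powi (int j - 2 * int k - 2)) *\<^sub>R
          (\<Sum>K | h \<notin> K. bracket J K ((partial_beta h ^^ (j - 1)) (\<lambda>w. F w $ insert h K) z)))" (is ?second)
proof -
  obtain F' where F': "\<And>z. z \<in> D \<Longrightarrow> (F has_derivative blinfun_apply (F' z)) (at z)"
    using F(2) unfolding C1_on_def by blast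
  have zero: "stem_dbar h F w = 0" if "w \<in> D" for w
    using slice_fun_eq_0[OF D(2) stem_function_dbar[OF D F(1) F'] _ that] dbar
    by (simp add: slice_dbar_def)
  define S where "S = {\<zeta>. upd_at h z \<zeta> \<in> D}"
  have "\<exists>V W. harmonic_tower S V W \<and> (\<forall>\<zeta>. V 0 \<zeta> = F (upd_at h z \<zeta>) $ insert h K)" if K: "h \<notin> K" for K
    using stem_dbar_eq_0_tower[OF D(1) F' zero K, of z] unfolding S_def by metis
  then obtain V W where VW: "\<And>K. h \<notin> K \<Longrightarrow> harmonic_tower S (V K) (W K)"
    and V0: "\<And>K \<zeta>. h \<notin> K \<Longrightarrow> V K 0 \<zeta> = F (upd_at h z \<zeta>) $ insert h K" by metis
  have S: "open S" using VW[of "{}"] by (simp add: harmonic_tower_def)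
  have zh: "z $ h \<in> S" using z by (simp add: S_def)
  \<comment> \<open>Quotients by \<beta> are differentiated only where \<beta> is positive.\<close>
  have S': "open (S \<inter> {\<zeta>. Im \<zeta> > 0})" "z $ h \<in> S \<inter> {\<zeta>. Im \<zeta> > 0}"
    using S zh z by (auto intro: open_Int open_halfspace_Im_gt)

  have F_beta: "(partial_beta h ^^ j) (\<lambda>w. F w $ insert h K) z = V K j (z $ h)"
    and F_diff: "dir_differentiable ((partial_beta h ^^ j) (\<lambda>w. F w $ insert h K)) (axis h \<i>) z"
    if K: "h \<notin> K" for j K
  proof -
    have "\<exists>L. (V K j has_derivative (\<lambda>d. Re d *\<^sub>R L + Im d *\<^sub>R V K (Suc j) \<zeta>)) (at \<zeta>)" if "\<zeta> \<in> S" for j \<zeta>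
      using VW[OF K] that unfolding harmonic_tower_def by blast
    from iterated_partial_beta[OF S zh, of "\<lambda>w. F w $ insert h K" h z "V K", OF _ this]
    show "(partial_beta h ^^ j) (\<lambda>w. F w $ insert h K) z = V K j (z $ h)"
      "dir_differentiable ((partial_beta h ^^ j) (\<lambda>w. F w $ insert h K)) (axis h \<i>) z"
      by (simp_all add: V0[OF K])
  qed
  have u_beta: "(partial_beta h ^^ j) (\<lambda>w. stem_spherical h F w $ K) z = quotient_tower (V K) j (z $ h)"
    and u_diff: "dir_differentiable ((partial_beta h ^^ j) (\<lambda>w. stem_spherical h F w $ K)) (axis h \<i>) z"
    if K: "h \<notin> K" for j K
  proof -
    have "\<exists>L. (quotient_tower (V K) j has_derivative
        (\<lambda>d. Re d *\<^sub>R L + Im d *\<^sub>R quotient_tower (V K) (Suc j) \<zeta>)) (at \<zeta>)"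
      if "\<zeta> \<in> S \<inter> {\<zeta>. Im \<zeta> > 0}" for j \<zeta>
      using that by (intro quotient_tower_has_derivative[OF VW[OF K]]) auto
    from iterated_partial_beta[OF S', of "\<lambda>w. stem_spherical h F w $ K" h z "quotient_tower (V K)", OF _ this]
    show "(partial_beta h ^^ j) (\<lambda>w. stem_spherical h F w $ K) z = quotient_tower (V K) j (z $ h)"
      "dir_differentiable ((partial_beta h ^^ j) (\<lambda>w. stem_spherical h F w $ K)) (axis h \<i>) z"
      using K by (simp_all add: V0[OF K] stem_spherical_def)
  qed
  show "dir_differentiable ((partial_beta h ^^ i) (\<lambda>w. stem_spherical h F w $ K)) (axis h \<i>) z \<and>
        dir_differentiable ((partial_beta h ^^ i) (\<lambda>w. F w $ insert h K)) (axis h \<i>) z"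
    if "h \<notin> K" for i K
    using u_diff F_diff that by blast

  \<comment> \<open>Brackets with fixed \<open>J\<close> are linear, so the towers of all components
    combine into one Clifford-valued tower over which the spherical derivative is radial.\<close>
  define T where "T j \<zeta> = (\<Sum>K | h \<notin> K. bracket J K (V K j \<zeta>))" for j \<zeta>
  have "harmonic_tower S (\<lambda>j \<zeta>. \<Sum>K | h \<notin> K. bracket J K (V K j \<zeta>)) (\<lambda>j \<zeta>. \<Sum>K | h \<notin> K. bracket J K (W K j \<zeta>))"
    using VW linear_bracket by (intro harmonic_tower_sum S) (simp_all add: linear_conv_bounded_linear)
  then have T: "harmonic_tower S T (\<lambda>j \<zeta>. \<Sum>K | h \<notin> K. bracket J K (W K j \<zeta>))"
    by (simp add: T_def[abs_def])
  have g: "spherical_deriv D h F (upd_at h x p) = radial (T 0) (- 1) p" if "p \<in> axial_domain S" for p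
    using spherical_deriv_radial[OF D(2) F(1) J that[unfolded S_def]]
    by (simp add: x_def T_def[abs_def] V0)
  have xh: "fst (x $ h) = Re (z $ h)" "norm (snd (x $ h)) = \<beta>"
    using imag_unit_norm[OF J[of h]] z by (simp_all add: x_def slice_point_def \<beta>_def)
  then have hp: "half_plane_coord (x $ h) = z $ h"
    by (simp add: half_plane_coord_def \<beta>_def)
  have b: "\<beta> > 0" using z by (simp add: \<beta>_def)
  have xS: "x $ h \<in> axial_domain S"
    using xh b zh hp by (auto simp: axial_domain_def)
  note L = iterated_laplacian_radial[OF T g xS, unfolded upd_at_same]
  show ?has by (rule L(1))
  have L2: "(laplacian_at h ^^ k) (spherical_deriv D h F) x =
      (\<Prod>i=1..k. real CARD('m) - 2 * real i - 1) *\<^sub>R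
        (\<Sum>j\<le>k. (a_coeff (Suc k) (Suc j) * \<beta> powi (int j - 2 * int k - 1)) *\<^sub>R T j (z $ h))"
    using L(2)[of k] by (simp add: radial_def hp xh)
  have "(\<Sum>j\<le>k. (a_coeff (Suc k) (Suc j) * \<beta> powi (int j - 2 * int k - 1)) *\<^sub>R T j (z $ h))
    = (\<Sum>j=1..k+1. (a_coeff (k + 1) j * \<beta> powi (int j - 2 * int k - 2)) *\<^sub>R
          (\<Sum>K | h \<notin> K. bracket J K ((partial_beta h ^^ (j - 1)) (\<lambda>w. F w $ insert h K) z)))"
    \<comment> \<open>Raising the index by one turns the exponent \<open>j - 2k - 1\<close> into
      \<open>j - 2k - 2\<close>.\<close>
    by (rule sum.reindex_bij_witness[of _ "\<lambda>j. j - 1" Suc])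
      (auto simp: T_def F_beta of_nat_diff algebra_simps)
  with L2 show ?second by simp
  \<comment> \<open>Moving the sum over \<open>j\<close> inside the brackets allows
    \<open>quotient_tower_sum\<close> to be applied to each \<open>K\<close> separately.\<close>
  have lin: "(\<Sum>j\<in>I. c j *\<^sub>R (\<Sum>K | h \<notin> K. bracket J K (X K j))) =
      (\<Sum>K | h \<notin> K. bracket J K (\<Sum>j\<in>I. c j *\<^sub>R X K j))" for I :: "nat set" and c X
    by (simp add: linear_sum[OF linear_bracket] linear_cmul[OF linear_bracket] scaleR_sum_right)
      (rule sum.swap)
  have "(\<Sum>j=1..k. (a_coeff k j * \<beta> powi (int j - 2 * int k)) *\<^sub>R
          (\<Sum>K | h \<notin> K. bracket J K ((partial_beta h ^^ j) (\<lambda>w. stem_spherical h F w $ K) z)))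
    = (\<Sum>K | h \<notin> K. bracket J K (\<Sum>j=1..k. (a_coeff k j * \<beta> powi (int j - 2 * int k)) *\<^sub>R
          quotient_tower (V K) j (z $ h)))"
    unfolding lin by (intro sum.cong refl arg_cong[where f = "bracket J _"]) (simp add: u_beta)
  also have "\<dots> = (\<Sum>j\<le>k. (a_coeff (Suc k) (Suc j) * \<beta> powi (int j - 2 * int k - 1)) *\<^sub>R T j (z $ h))"
    unfolding T_def lin \<beta>_def using z by (subst quotient_tower_sum[OF k]) auto
  finally show ?first using L2 by simp
qed

text \<open>Conjugating \<open>z\<close> in the \<open>h\<close>-th variable and negating
  \<open>J $ h\<close> represents the same point, so the formulas for positive \<beta> reach every
  point with nonreal \<open>h\<close>-th variable.\<close>

lemma circularization_upper_half_plane: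
  fixes D :: "(complex ^ 'n::finite) set" and x :: "'m::finite paravector ^ 'n::finite"
  assumes D: "symmetric_set D" and x: "x \<in> circularization D" "snd (x $ h) \<noteq> 0"
  obtains z J where "z \<in> D" "\<And>l. J $ l \<in> imag_units" "x = slice_point z J" "Im (z $ h) > 0"
proof -
  obtain z J where z: "z \<in> D" and J: "\<And>l. J $ l \<in> imag_units" and xz: "x = slice_point z J"
    using x(1) by (auto simp: circularization_def)
  have "Im (z $ h) \<noteq> 0" using x(2) by (auto simp: xz slice_point_def)
  then consider "Im (z $ h) > 0" | "Im (z $ h) < 0" by linarith
  then show thesis
  proof cases
    case 1
    then show thesis using that z J xz by blast
  next
    case 2
    have "upd_at h J (- (J $ h)) $ l \<in> imag_units" for l
      using J[of l] by (auto simp: imag_units_def)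
    moreover have "x = slice_point (conj_at h z) (upd_at h J (- (J $ h)))"
      by (simp add: xz slice_point_def conj_at_def vec_eq_iff)
    moreover have "conj_at h z \<in> D" "Im (conj_at h z $ h) > 0"
      using D z 2 by (simp_all add: symmetric_set_def conj_at_def)
    ultimately show thesis using that by blast
  qed
qed

theorem proposition3p6:
  fixes D :: "(complex ^ 'n::{finite,linorder}) set"
    and F :: "complex ^ 'n::{finite,linorder} \<Rightarrow> ('m::{finite,linorder}, 'n) stem_value"
    and h :: 'n
  assumes "odd CARD('m)"
    and "open D" and "symmetric_set D"
    and "stem_function D F" and "C1_on D F"
    and "\<forall>x\<in>circularization D. slice_dbar D h F x = 0"
  shows "(\<forall>k z J x. 1 \<le> k \<and> z \<in> D \<and> (\<forall>l. J $ l \<in> imag_units) \<and> x = slice_point z J \<and> Im (z $ h) > 0 \<longrightarrow>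
      has_laplacian_at h ((laplacian_at h ^^ (k - 1)) (spherical_deriv D h F)) x \<and>
      (\<forall>i K. h \<notin> K \<longrightarrow>
        dir_differentiable ((partial_beta h ^^ i) (\<lambda>w. stem_spherical h F w $ K)) (axis h \<i>) z \<and>
        dir_differentiable ((partial_beta h ^^ i) (\<lambda>w. F w $ insert h K)) (axis h \<i>) z) \<and>
      (laplacian_at h ^^ k) (spherical_deriv D h F) x =
        (\<Prod>i=1..k. real CARD('m) - 2 * real i - 1) *\<^sub>R
        (\<Sum>j=1..k. (a_coeff k j * Im (z $ h) powi (int j - 2 * int k)) *\<^sub>R
          (\<Sum>K | h \<notin> K. bracket J K ((partial_beta h ^^ j) (\<lambda>w. stem_spherical h F w $ K) z))) \<and>
      (laplacian_at h ^^ k) (spherical_deriv D h F) x =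
        (\<Prod>i=1..k. real CARD('m) - 2 * real i - 1) *\<^sub>R
        (\<Sum>j=1..k+1. (a_coeff (k + 1) j * Im (z $ h) powi (int j - 2 * int k - 2)) *\<^sub>R
          (\<Sum>K | h \<notin> K. bracket J K ((partial_beta h ^^ (j - 1)) (\<lambda>w. F w $ insert h K) z)))) \<and>
    (1 \<le> (CARD('m) - 1) div 2 \<longrightarrow>
      (\<forall>x\<in>circularization D. snd (x $ h) \<noteq> 0 \<longrightarrow>
        (laplacian_at h ^^ ((CARD('m) - 1) div 2)) (spherical_deriv D h F) x = 0))"
proof (intro conjI impI ballI allI)
  fix k :: nat and z x and J :: "'m paravector ^ 'n::{finite,linorder}"
  assume *: "1 \<le> k \<and> z \<in> D \<and> (\<forall>l. J $ l \<in> imag_units) \<and> x = slice_point z J \<and> Im (z $ h) > 0"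
  then have k: "1 \<le> k" and z: "z \<in> D" "Im (z $ h) > 0"
    and J: "\<And>l. J $ l \<in> imag_units" and x: "x = slice_point z J" by blast+
  note L = spherical_deriv_laplacian[OF assms(2-6) k z J, folded x]
  show "has_laplacian_at h ((laplacian_at h ^^ (k - 1)) (spherical_deriv D h F)) x"
    by (rule L(1))
  show "(laplacian_at h ^^ k) (spherical_deriv D h F) x =
      (\<Prod>i=1..k. real CARD('m) - 2 * real i - 1) *\<^sub>R
      (\<Sum>j=1..k. (a_coeff k j * Im (z $ h) powi (int j - 2 * int k)) *\<^sub>R
        (\<Sum>K | h \<notin> K. bracket J K ((partial_beta h ^^ j) (\<lambda>w. stem_spherical h F w $ K) z)))"
    by (rule L(3))
  show "(laplacian_at h ^^ k) (spherical_deriv D h F) x =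
      (\<Prod>i=1..k. real CARD('m) - 2 * real i - 1) *\<^sub>R
      (\<Sum>j=1..k+1. (a_coeff (k + 1) j * Im (z $ h) powi (int j - 2 * int k - 2)) *\<^sub>R
        (\<Sum>K | h \<notin> K. bracket J K ((partial_beta h ^^ (j - 1)) (\<lambda>w. F w $ insert h K) z)))"
    by (rule L(4))
  fix i and K :: "'n set"
  assume K: "h \<notin> K"
  show "dir_differentiable ((partial_beta h ^^ i) (\<lambda>w. stem_spherical h F w $ K)) (axis h \<i>) z"
    "dir_differentiable ((partial_beta h ^^ i) (\<lambda>w. F w $ insert h K)) (axis h \<i>) z"
    using L(2)[OF K] by blast+
next
  fix x :: "'m paravector ^ 'n::{finite,linorder}"
  let ?\<gamma> = "(CARD('m) - 1) div 2"
  assume \<gamma>: "1 \<le> ?\<gamma>" and x: "x \<in> circularization D" "snd (x $ h) \<noteq> 0"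
  obtain z J where z: "z \<in> D" "\<And>l. J $ l \<in> imag_units" "x = slice_point z J" "Im (z $ h) > 0"
    using circularization_upper_half_plane[OF assms(3) x] by blast
  have "CARD('m) = 2 * ?\<gamma> + 1" using assms(1) by (auto elim: oddE)
  then have "real CARD('m) - 2 * real ?\<gamma> - 1 = 0" by linarith
  \<comment> \<open>The factor \<open>i = ?\<gamma>\<close> vanishes. It occurs in the product
    because \<open>?\<gamma>\<close> is at least 1; for \<open>CARD('m) = 1\<close> the product
    would be empty.\<close>
  then have "(\<Prod>i=1..?\<gamma>. real CARD('m) - 2 * real i - 1) = 0"
    using \<gamma> by (intro prod_zero) auto
  then show "(laplacian_at h ^^ ?\<gamma>) (spherical_deriv D h F) x = 0"
    unfolding z(3) spherical_deriv_laplacian(3)[OF assms(2-6) \<gamma> z(1,4,2)] by simp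
qed

end
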